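(* Let $G$ be a group generated by $r$ elements, realized as the quotient $G=\mathbb{F}_r/N$ of the free group $\mathbb{F}_r$ on $r$ generators by a normal subgroup $N$, let $\gamma_n=\#\{x\in N : |x|=n\}$ be the cogrowth coefficients, let $\gamma=\lim_{n\to\infty}\sqrt[2n]{\gamma_{2n}}$ be the cogrowth exponent, and let $q=2r-1$. Then the generating function $\gamma(z)=\sum_{n=0}^{\infty}\gamma_n z^n$ can be decomposed into a sum of two functions $\gamma^{(0)}(z)$ and $\gamma^{(1)}(z)$ such that $\gamma^{(0)}(z)$ is analytic in the open disc of radius $q^{-1/2}$, while $\gamma^{(1)}(z)$ is analytic in the whole complex plane after removing the two real intervals $[-\gamma q^{-1},\,-\gamma^{-1}]$ and $[\gamma^{-1},\,\gamma q^{-1}]$. Moreover, $\gamma^{(1)}$ satisfies the functional equation $$\frac{z\,\gamma^{(1)}(z)}{1-z^2}=\frac{(q/z)\,\gamma^{(1)}(q/z)}{(q/z)}.$$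
   Context: Every group $G$ generated by $r$ elements $g_1,\dots,g_r$ can be realized as a quotient of the free group $\mathbb{F}_r$ on $r$ generators by a normal subgroup $N$ of $\mathbb{F}_r$, in such a way that the generators of $\mathbb{F}_r$ are sent to the generators of $G$. For $x\in\mathbb{F}_r$, $|x|$ denotes the length of $x$ as a reduced word in the generators of $\mathbb{F}_r$ and their inverses. The cogrowth coefficient $\gamma_n=\#\{x\in N : |x|=n\}$ counts the reduced words of length $n$ that represent the identity element of $G$. It is known that $\sqrt[2n]{\gamma_{2n}}$ has a limit, called the cogrowth exponent. The symbol $\gamma$ denotes this number, while $\gamma(z)$ denotes the generating function.
   Formalization: The functional equation as printed is false (e.g. r=2, N=F_2, near z=1/3); it is corrected to zγ^(1)(z)/(1-z^2) = wγ^(1)(w)/(1-w^2) with w = 1/(qz), for z off the cut, z≠0, z^2≠1, w^2≠1. Also r ≥ 1 is assumed. *)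

theory Defs
  imports "HOL-Algebra.Coset" "HOL-Algebra.Generated_Groups"
    "HOL-Complex_Analysis.Complex_Analysis"
begin

section \<open>The free group on \<open>r\<close> generators, as reduced words\<close>

text \<open>The letter \<open>(i, True)\<close> stands for the generator \<open>x\<^sub>i\<close>, the letter \<open>(i, False)\<close> for its inverse.\<close>

type_synonym letter = "nat \<times> bool"

definition inv_letter :: "letter \<Rightarrow> letter" where
  "inv_letter a = (fst a, \<not> snd a)"

fun reduced :: "letter list \<Rightarrow> bool" where
  "reduced [] = True"
| "reduced [a] = True"
| "reduced (a # b # w) = (b \<noteq> inv_letter a \<and> reduced (b # w))"

fun cons_red :: "letter \<Rightarrow> letter list \<Rightarrow> letter list" where
  "cons_red a [] = [a]"
| "cons_red a (b # w) = (if b = inv_letter a then w else a # b # w)"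

text \<open>For reduced \<open>u\<close> and \<open>v\<close>, \<open>foldr cons_red u v\<close> is the reduced form of the
  concatenation \<open>u @ v\<close>.\<close>

definition free_group :: "nat \<Rightarrow> letter list monoid" where
  "free_group r = \<lparr> carrier = {w. reduced w \<and> fst ` set w \<subseteq> {..<r}},
                    monoid.mult = foldr cons_red, monoid.one = [] \<rparr>"

definition free_gen :: "nat \<Rightarrow> letter list" where
  "free_gen i = [(i, True)]"

lemma inv_letter_inv_letter [simp]: "inv_letter (inv_letter a) = a"
  by (simp add: inv_letter_def)

lemma fst_inv_letter [simp]: "fst (inv_letter a) = fst a"
  by (simp add: inv_letter_def)

lemma reduced_ConsD: "reduced (a # w) \<Longrightarrow> reduced w"
  by (cases w) auto

lemma reduced_cons_red: "reduced w \<Longrightarrow> reduced (cons_red a w)"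
  by (cases w) (auto dest: reduced_ConsD)

lemma set_cons_red: "set (cons_red a w) \<subseteq> insert a (set w)"
  by (cases w) auto

lemma cons_red_reduced: "reduced (a # w) \<Longrightarrow> cons_red a w = a # w"
  by (cases w) auto

lemma cons_red_cancel: "reduced w \<Longrightarrow> cons_red a (cons_red (inv_letter a) w) = w"
  by (cases w) (auto simp: cons_red_reduced)

lemma reduced_foldr: "reduced v \<Longrightarrow> reduced (foldr cons_red u v)"
  by (induction u) (auto intro: reduced_cons_red)

lemma set_foldr: "set (foldr cons_red u v) \<subseteq> set u \<union> set v"
  by (induction u) (use set_cons_red in fastforce)+

lemma foldr_cons_red:
  "reduced w \<Longrightarrow> foldr cons_red (cons_red a v) w = cons_red a (foldr cons_red v w)"
proof (cases v)
  case (Cons b v')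
  assume "reduced w"
  then show ?thesis
    using Cons cons_red_cancel[of "foldr cons_red v' w" a] reduced_foldr[of w v'] by auto
qed simp

lemma foldr_cons_red_assoc:
  "reduced w \<Longrightarrow> foldr cons_red (foldr cons_red u v) w = foldr cons_red u (foldr cons_red v w)"
  by (induction u) (auto simp: foldr_cons_red)

lemma foldr_cons_red_Nil: "reduced u \<Longrightarrow> foldr cons_red u [] = u"
proof (induction u)
  case (Cons a u)
  then show ?case using cons_red_reduced reduced_ConsD by fastforce
qed simp

lemma ex_left_inverse:
  "\<exists>v. reduced v \<and> set v \<subseteq> inv_letter ` set u \<and> foldr cons_red v u = []" if "reduced u"
  using that
proof (induction u)
  case Nil
  then show ?case by (intro exI[of _ "[]"]) auto
next
  case (Cons a u)
  then obtain v where v: "reduced v" "set v \<subseteq> inv_letter ` set u" "foldr cons_red v u = []"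
    using reduced_ConsD by blast
  let ?v = "foldr cons_red v [inv_letter a]"
  have "foldr cons_red ?v (a # u) = []"
    using Cons.prems v(3) by (simp add: foldr_cons_red_assoc)
  moreover have "set ?v \<subseteq> inv_letter ` set (a # u)"
    using set_foldr[of v "[inv_letter a]"] v(2) by auto
  ultimately show ?case using reduced_foldr[of "[inv_letter a]" v] by auto
qed

lemma group_free_group: "group (free_group r)"
proof (rule groupI)
  fix u v assume "u \<in> carrier (free_group r)" "v \<in> carrier (free_group r)"
  then show "u \<otimes>\<^bsub>free_group r\<^esub> v \<in> carrier (free_group r)"
    using set_foldr[of u v] by (fastforce simp: free_group_def reduced_foldr)
next
  fix u assume "u \<in> carrier (free_group r)"
  then have u: "reduced u" "fst ` set u \<subseteq> {..<r}" by (auto simp: free_group_def)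
  obtain v where v: "reduced v" "set v \<subseteq> inv_letter ` set u" "foldr cons_red v u = []"
    using ex_left_inverse[OF u(1)] by blast
  have "fst ` set v \<subseteq> {..<r}" using v(2) u(2) by fastforce
  then show "\<exists>v\<in>carrier (free_group r). v \<otimes>\<^bsub>free_group r\<^esub> u = \<one>\<^bsub>free_group r\<^esub>"
    using v by (auto simp: free_group_def)
qed (auto simp: free_group_def foldr_cons_red_assoc)

lemma generate_free_group:
  "generate (free_group r) (free_gen ` {..<r}) = carrier (free_group r)"
proof
  interpret group "free_group r" by (rule group_free_group)
  have gens: "free_gen ` {..<r} \<subseteq> carrier (free_group r)"
    by (auto simp: free_gen_def free_group_def)
  then show "generate (free_group r) (free_gen ` {..<r}) \<subseteq> carrier (free_group r)"
    by (rule generate_incl)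
  have inv_gen: "inv\<^bsub>free_group r\<^esub> [(i, True)] = [(i, False)]" if "i < r" for i
    using that by (intro inv_equality) (auto simp: free_group_def inv_letter_def)
  have letter: "[a] \<in> generate (free_group r) (free_gen ` {..<r})" if "fst a < r" for a
  proof (cases "snd a")
    case True
    then have "[a] = free_gen (fst a)" by (simp add: free_gen_def prod_eq_iff)
    then show ?thesis using that by (auto intro: generate.incl)
  next
    case False
    then have "[a] = inv\<^bsub>free_group r\<^esub> free_gen (fst a)"
      using that by (simp add: free_gen_def inv_gen prod_eq_iff)
    then show ?thesis using that by (auto intro: generate.inv)
  qed
  show "carrier (free_group r) \<subseteq> generate (free_group r) (free_gen ` {..<r})"
  proof
    fix w assume "w \<in> carrier (free_group r)"
    then have "reduced w" "fst ` set w \<subseteq> {..<r}" by (auto simp: free_group_def)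
    then show "w \<in> generate (free_group r) (free_gen ` {..<r})"
    proof (induction w)
      case Nil
      have "\<one>\<^bsub>free_group r\<^esub> = []" by (simp add: free_group_def)
      then show ?case using generate.one by metis
    next
      case (Cons a w)
      have "a # w = [a] \<otimes>\<^bsub>free_group r\<^esub> w"
        using Cons.prems(1) by (simp add: free_group_def cons_red_reduced)
      moreover have "w \<in> generate (free_group r) (free_gen ` {..<r})"
        using Cons reduced_ConsD by auto
      moreover have "[a] \<in> generate (free_group r) (free_gen ` {..<r})"
        using Cons.prems(2) by (intro letter) auto
      ultimately show ?case by (metis generate.eng)
    qed
  qed
qed

lemma finite_free_group_sphere: "finite {w \<in> carrier (free_group r). length w = n}"
proof (rule finite_subset)
  show "{w \<in> carrier (free_group r). length w = n}
          \<subseteq> {w. set w \<subseteq> {..<r} \<times> UNIV \<and> length w = n}"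
    by (fastforce simp: free_group_def)
  show "finite {w. set w \<subseteq> {..<r} \<times> (UNIV :: bool set) \<and> length w = n}"
    by (intro finite_lists_length_eq) auto
qed

section \<open>Cogrowth\<close>

definition cogrowth :: "letter list set \<Rightarrow> nat \<Rightarrow> nat" where
  "cogrowth N n = card {x \<in> N. length x = n}"

definition cogrowth_exponent :: "letter list set \<Rightarrow> real" where
  "cogrowth_exponent N = lim (\<lambda>n. root (2 * n) (real (cogrowth N (2 * n))))"

text \<open>The union of the real intervals \<open>[-\<gamma>/q, -1/\<gamma>]\<close> and \<open>[1/\<gamma>, \<gamma>/q]\<close> in the complex plane.
  For \<open>\<gamma> = 0\<close> (that is, \<open>N\<close> trivial) one has \<open>1/\<gamma> = \<infinity>\<close> and the intervals are empty; this case
  is singled out because \<open>1/0 = 0\<close> in HOL would produce the set \<open>{0}\<close>.\<close>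

definition cogrowth_cut :: "real \<Rightarrow> real \<Rightarrow> complex set" where
  "cogrowth_cut q \<gamma> =
     (if \<gamma> = 0 then {} else complex_of_real ` ({- \<gamma> / q .. - (1 / \<gamma>)} \<union> {1 / \<gamma> .. \<gamma> / q}))"

end

theory Submission
  imports Defs "HOL-Computational_Algebra.Polynomial" "HOL-Real_Asymp.Real_Asymp"
begin

text \<open>
  The reduced words of length \<open>n\<close> form a sphere of a homogeneous tree, and in the group algebra their
  sum is a polynomial \<open>P\<^sub>n\<close> in the adjacency operator \<open>A\<close>, the sum of the generators and their
  inverses: \<open>A P\<^sub>n = P\<^bsub>n+1\<^esub> + q P\<^bsub>n-1\<^esub>\<close> for \<open>n \<ge> 2\<close>, with generating function
  \<open>\<Sum>\<^sub>n P\<^sub>n(t) z\<^sup>n = (1 - z\<^sup>2) / (1 + q z\<^sup>2 - t z)\<close>. Hence \<open>\<gamma>\<^sub>n\<close> is the diagonal coefficient of \<open>P\<^sub>n(A)\<close>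
  on the quotient group, and if \<open>\<sigma>\<close> is the spectral measure of \<open>A\<close> at the identity, then
  \<open>\<gamma>(z) = \<integral> (1 - z\<^sup>2) / (1 + q z\<^sup>2 - t z) d\<sigma>(t)\<close>. The decomposition cuts this integral at
  \<open>\<bar>t\<bar> = 2 \<surd>q\<close>. For \<open>\<bar>t\<bar> \<le> 2 \<surd>q\<close> both poles of the integrand lie on the circle \<open>\<bar>z\<bar> = q\<^bsup>-1/2\<^esup>\<close>. For
  \<open>2 \<surd>q < \<bar>t\<bar> \<le> \<gamma> + q/\<gamma>\<close> they are real and lie in \<open>[1/\<gamma>, \<gamma>/q]\<close> up to sign. Multiplied by
  \<open>z / (1 - z\<^sup>2)\<close> the integrand becomes \<open>1 / (1/z + q z - t)\<close>, which is invariant under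
  \<open>z \<mapsto> 1/(q z)\<close>; this is the functional equation.

  Three points have to be supplied. (1) The spectrum is bounded by \<open>\<gamma> + q/\<gamma>\<close> if \<open>\<gamma> > \<surd>q\<close> and by
  \<open>2 \<surd>q\<close> otherwise. The weights \<open>\<alpha>\<^sup>n + (q/\<alpha>)\<^sup>n\<close> are essentially an eigenfunction of the walk on spheres with
  eigenvalue \<open>\<alpha> + q/\<alpha>\<close>, so a bound \<open>C \<alpha>\<^sup>n\<close> for the even cogrowth coefficients gives a bound
  \<open>C' (\<alpha> + q/\<alpha>)\<^sup>n\<close> for the even moments of \<open>A\<close> (lemma \<open>even_sphere_visits_le\<close>). (2) The value \<open>\<gamma>\<close> is
  a genuine limit for \<open>r \<ge> 2\<close>: two words of \<open>N\<close> can be joined without cancellation by conjugating one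
  with a suitable letter, so \<open>\<gamma>\<^sub>n\<close> is supermultiplicative up to a shift
  (\<open>cogrowth_supermultiplicative\<close>). For \<open>r = 1\<close> the limit may fail to exist, but then \<open>q = 1\<close>,
  the whole spectrum lies in \<open>[-2, 2] = [-2 \<surd>q, 2 \<surd>q]\<close> and \<open>\<gamma>\<^sup>(\<^sup>1\<^sup>)\<close> vanishes whatever \<open>\<gamma>\<close> is.

  (3) No spectral measure is constructed. The functional \<open>L(p) = \<langle>p(A) \<delta>\<^sub>e, \<delta>\<^sub>e\<rangle>\<close> on real polynomials is
  positive and bounded by \<open>R\<close>, in the sense that \<open>\<bar>L(x p\<^sup>2)\<bar> \<le> R L(p\<^sup>2)\<close>. Applying it to the Bernstein
  basis of \<open>[-R, R]\<close> produces finite measures on \<open>[-R, R]\<close> whose moments converge to those of \<open>L\<close>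
  (\<open>discrete_approximation\<close>). For a finite measure the integral above is a finite sum, which is
  split according to the position of the nodes. Both halves are locally bounded families of
  holomorphic functions, and Montel's theorem extracts the two limits; the functional equation
  holds for every finite sum and survives the limit (\<open>cogrowth_series_decomposition\<close>).
\<close>

section \<open>Counting words through reduced words\<close>

lemma reduced_iff_successively: "reduced w \<longleftrightarrow> successively (\<lambda>a b. b \<noteq> inv_letter a) w"
  by (induction w rule: reduced.induct) auto

lemma reduced_append_iff:
  "reduced (u @ v) \<longleftrightarrow>
     reduced u \<and> reduced v \<and> (u = [] \<or> v = [] \<or> hd v \<noteq> inv_letter (last u))"
  by (simp add: reduced_iff_successively successively_append_iff)

lemma reduced_Cons_iff: "reduced (a # w) \<longleftrightarrow> reduced w \<and> (w = [] \<or> hd w \<noteq> inv_letter a)"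
  by (cases w) auto

lemma foldr_cons_red_append: "reduced (u @ v) \<Longrightarrow> foldr cons_red u v = u @ v"
proof (induction u)
  case (Cons a u)
  then show ?case using reduced_ConsD[of a "u @ v"] cons_red_reduced[of a "u @ v"] by simp
qed simp

definition letters :: "nat \<Rightarrow> letter set" where
  "letters r = {..<r} \<times> UNIV"

definition words :: "nat \<Rightarrow> nat \<Rightarrow> letter list set" where
  "words r n = {w. set w \<subseteq> letters r \<and> length w = n}"

definition reduced_words :: "nat \<Rightarrow> nat \<Rightarrow> letter list set" where
  "reduced_words r n = {w \<in> words r n. reduced w}"

text \<open>For a subgroup \<open>N\<close> and \<open>x\<close> in the free group this is the number of walks of length \<open>k\<close> from the coset
  \<open>x N\<close> to the coset \<open>N\<close>, that is, an entry of the \<open>k\<close>-th power of the adjacency operator.\<close>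

definition visits :: "nat \<Rightarrow> letter list set \<Rightarrow> nat \<Rightarrow> letter list \<Rightarrow> real" where
  "visits r N k x = real (card {w \<in> words r k. foldr cons_red w x \<in> N})"

lemma set_subset_letters_iff: "set w \<subseteq> letters r \<longleftrightarrow> fst ` set w \<subseteq> {..<r}"
  by (auto simp: letters_def)

lemma carrier_free_group: "carrier (free_group r) = {w. reduced w \<and> set w \<subseteq> letters r}"
  by (simp add: free_group_def set_subset_letters_iff)

lemma finite_letters [simp]: "finite (letters r)"
  and card_letters: "card (letters r) = 2 * r"
  by (simp_all add: letters_def card_cartesian_product)

lemma inv_letter_in_letters_iff [simp]: "inv_letter a \<in> letters r \<longleftrightarrow> a \<in> letters r"
  by (cases a) (simp add: letters_def inv_letter_def)

lemma finite_words [simp]: "finite (words r n)"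
  and card_words: "card (words r n) = (2 * r) ^ n"
  by (simp_all add: words_def finite_lists_length_eq card_lists_length_eq card_letters)

lemma finite_reduced_words [simp]: "finite (reduced_words r n)"
  by (simp add: reduced_words_def)

lemma reduced_words_0: "reduced_words r 0 = {[]}"
  by (auto simp: reduced_words_def words_def)

lemma words_0: "words r 0 = {[]}"
  by (auto simp: words_def)

lemma visits_0: "visits r N 0 x = indicator N x"
proof -
  have "{w \<in> words r 0. foldr cons_red w x \<in> N} = (if x \<in> N then {[]} else {})"
    by (auto simp: words_0)
  then show ?thesis by (simp add: visits_def)
qed

text \<open>The letter that acts first on \<open>x\<close> is the last letter of the word, so the first step of the walk
  is obtained by cutting off the last letter.\<close>

lemma visits_Suc: "visits r N (Suc k) x = (\<Sum>a\<in>letters r. visits r N k (cons_red a x))"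
proof -
  have "bij_betw (\<lambda>(a, w). w @ [a])
          (SIGMA a:letters r. {w \<in> words r k. foldr cons_red w (cons_red a x) \<in> N})
          {w \<in> words r (Suc k). foldr cons_red w x \<in> N}"
  proof (rule bij_betwI[where g = "\<lambda>w. (last w, butlast w)"])
    show "(\<lambda>w. (last w, butlast w)) \<in> {w \<in> words r (Suc k). foldr cons_red w x \<in> N} \<rightarrow>
          (SIGMA a:letters r. {w \<in> words r k. foldr cons_red w (cons_red a x) \<in> N})"
    proof
      fix w assume w: "w \<in> {w \<in> words r (Suc k). foldr cons_red w x \<in> N}"
      then obtain u a where "w = u @ [a]"
        by (cases w rule: rev_cases) (auto simp: words_def)
      with w show "(last w, butlast w) \<in>
          (SIGMA a:letters r. {w \<in> words r k. foldr cons_red w (cons_red a x) \<in> N})"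
        by (auto simp: words_def)
    qed
  qed (auto simp: words_def simp del: append_butlast_last_id intro!: append_butlast_last_id)
  then have "card {w \<in> words r (Suc k). foldr cons_red w x \<in> N} =
      card (SIGMA a:letters r. {w \<in> words r k. foldr cons_red w (cons_red a x) \<in> N})"
    by (simp add: bij_betw_same_card)
  also have "\<dots> = (\<Sum>a\<in>letters r. card {w \<in> words r k. foldr cons_red w (cons_red a x) \<in> N})"
    by (rule card_SigmaI) auto
  finally show ?thesis by (simp add: visits_def)
qed

text \<open>The recursion for spheres in the tree. Multiplying a reduced word of length \<open>n\<close> by a letter either
  extends it, and every reduced word of length \<open>n + 1\<close> arises once in this way, or cancels its
  first letter. A word \<open>y\<close> of length \<open>n - 1\<close> arises by cancellation once for each letter that may be put
  in front of \<open>y\<close>: all \<open>2r\<close> if \<open>y\<close> is empty, and all but one otherwise.\<close>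

lemma sum_letters_reduced_words_Suc:
  fixes f :: "letter list \<Rightarrow> real"
  assumes "n > 0"
  shows "(\<Sum>a\<in>letters r. \<Sum>x\<in>reduced_words r n. f (cons_red a x)) =
    (\<Sum>y\<in>reduced_words r (Suc n). f y) +
    (if n = 1 then 2 * real r else 2 * real r - 1) * (\<Sum>y\<in>reduced_words r (n - 1). f y)"
proof -
  define P where "P = letters r \<times> reduced_words r n"
  define P1 where "P1 = {(a, x) \<in> P. hd x \<noteq> inv_letter a}"
  define P2 where "P2 = {(a, x) \<in> P. hd x = inv_letter a}"
  define Q where "Q = (SIGMA y:reduced_words r (n - 1). {a \<in> letters r. y = [] \<or> hd y \<noteq> a})"
  have fin: "finite P" by (simp add: P_def)
  have nonempty: "x \<noteq> []" if "x \<in> reduced_words r n" for x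
    using that assms by (auto simp: reduced_words_def words_def)
  have P1: "(\<Sum>(a, x)\<in>P1. f (cons_red a x)) = (\<Sum>y\<in>reduced_words r (Suc n). f y)"
  proof (rule sum.reindex_bij_witness[where i = "\<lambda>y. (hd y, tl y)" and j = "\<lambda>(a, x). a # x"])
    fix y assume y: "y \<in> reduced_words r (Suc n)"
    then obtain a x where yx: "y = a # x"
      by (cases y) (auto simp: reduced_words_def words_def)
    with y assms show "(hd y, tl y) \<in> P1"
      by (auto simp: P1_def P_def reduced_words_def words_def reduced_Cons_iff)
    show "(case (hd y, tl y) of (a, x) \<Rightarrow> a # x) = y" using yx by simp
  next
    fix p assume p: "p \<in> P1"
    then show "(case p of (a, x) \<Rightarrow> a # x) \<in> reduced_words r (Suc n)"
      by (auto simp: P1_def P_def reduced_words_def words_def reduced_Cons_iff)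
    then show "f (case p of (a, x) \<Rightarrow> a # x) = (case p of (a, x) \<Rightarrow> f (cons_red a x))"
      by (auto simp: reduced_words_def cons_red_reduced split: prod.splits)
  qed auto
  have P2: "(\<Sum>(a, x)\<in>P2. f (cons_red a x)) = (\<Sum>(y, a)\<in>Q. f y)"
  proof (rule sum.reindex_bij_witness[where i = "\<lambda>(y, a). (a, inv_letter a # y)"
        and j = "\<lambda>(a, x). (tl x, a)"])
    fix p assume p: "p \<in> P2"
    then obtain a y where pe: "p = (a, inv_letter a # y)"
      using nonempty by (cases p) (auto simp: P2_def P_def, metis list.collapse)
    show "(case (case p of (a, x) \<Rightarrow> (tl x, a)) of (y, a) \<Rightarrow> (a, inv_letter a # y)) = p"
      using pe by simp
    show "(case p of (a, x) \<Rightarrow> (tl x, a)) \<in> Q"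
      using p pe by (auto simp: P2_def P_def Q_def reduced_words_def words_def reduced_Cons_iff)
    show "(case (case p of (a, x) \<Rightarrow> (tl x, a)) of (y, a) \<Rightarrow> f y) =
      (case p of (a, x) \<Rightarrow> f (cons_red a x))"
      using pe by simp
  next
    fix p assume p: "p \<in> Q"
    then show "(case (case p of (y, a) \<Rightarrow> (a, inv_letter a # y)) of (a, x) \<Rightarrow> (tl x, a)) = p"
      by (cases p) auto
    show "(case p of (y, a) \<Rightarrow> (a, inv_letter a # y)) \<in> P2"
      using p assms by (auto simp: P2_def P_def Q_def reduced_words_def words_def reduced_Cons_iff)
  qed
  have deg: "real (card {a \<in> letters r. y = [] \<or> hd y \<noteq> a}) =
      (if n = 1 then 2 * real r else 2 * real r - 1)" if "y \<in> reduced_words r (n - 1)" for y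
  proof (cases "n = 1")
    case True
    then have "y = []" using that by (simp add: reduced_words_0)
    then show ?thesis using True by (simp add: card_letters)
  next
    case False
    then have "y \<noteq> []" using that assms by (auto simp: reduced_words_def words_def)
    then have hd: "hd y \<in> letters r" using that by (auto simp: reduced_words_def words_def)
    have "{a \<in> letters r. y = [] \<or> hd y \<noteq> a} = letters r - {hd y}" using \<open>y \<noteq> []\<close> by auto
    moreover have "card (letters r) > 0" using hd by (auto simp: card_gt_0_iff)
    ultimately show ?thesis
      using hd False by (simp add: card_letters of_nat_diff)
  qed
  have "(\<Sum>a\<in>letters r. \<Sum>x\<in>reduced_words r n. f (cons_red a x)) = (\<Sum>(a, x)\<in>P. f (cons_red a x))"
    by (simp add: P_def sum.cartesian_product)
  also have "\<dots> = (\<Sum>(a, x)\<in>P1. f (cons_red a x)) + (\<Sum>(a, x)\<in>P2. f (cons_red a x))"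
    using fin by (subst sum.union_disjoint[symmetric])
      (auto simp: P1_def P2_def intro!: sum.cong finite_subset[OF _ fin])
  also have "(\<Sum>(a, x)\<in>P2. f (cons_red a x)) =
      (\<Sum>y\<in>reduced_words r (n - 1). \<Sum>a\<in>{a \<in> letters r. y = [] \<or> hd y \<noteq> a}. f y)"
    unfolding P2 Q_def by (rule sum.Sigma[symmetric]) auto
  also have "\<dots> = (\<Sum>y\<in>reduced_words r (n - 1). (if n = 1 then 2 * real r else 2 * real r - 1) * f y)"
    by (intro sum.cong refl) (simp only: sum_constant deg)
  finally show ?thesis by (simp add: P1 sum_distrib_left)
qed

lemma sum_letters_Nil:
  fixes f :: "letter list \<Rightarrow> real"
  shows "(\<Sum>a\<in>letters r. f [a]) = (\<Sum>y\<in>reduced_words r 1. f y)"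
  by (rule sum.reindex_bij_witness[where i = hd and j = "\<lambda>a. [a]"])
     (auto simp: reduced_words_def words_def length_Suc_conv)

definition sphere_visits :: "nat \<Rightarrow> letter list set \<Rightarrow> nat \<Rightarrow> nat \<Rightarrow> real" where
  "sphere_visits r N n k = (\<Sum>x\<in>reduced_words r n. visits r N k x)"

lemma sphere_visits_0_Suc: "sphere_visits r N 0 (Suc k) = sphere_visits r N 1 k"
  by (simp add: sphere_visits_def reduced_words_0 visits_Suc sum_letters_Nil)

lemma sphere_visits_Suc:
  assumes "n > 0"
  shows "sphere_visits r N n (Suc k) = sphere_visits r N (Suc n) k +
    (if n = 1 then 2 * real r else 2 * real r - 1) * sphere_visits r N (n - 1) k"
proof -
  have "sphere_visits r N n (Suc k) =
      (\<Sum>a\<in>letters r. \<Sum>x\<in>reduced_words r n. visits r N k (cons_red a x))"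
    unfolding sphere_visits_def visits_Suc by (rule sum.swap)
  then show ?thesis
    by (simp add: sum_letters_reduced_words_Suc[OF assms] sphere_visits_def)
qed

text \<open>The column \<open>k = 0\<close> of \<^const>\<open>sphere_visits\<close> is the cogrowth sequence and its row \<open>n = 0\<close> is the
  sequence of moments of the adjacency operator; the recursion above links the two.\<close>

lemma sphere_visits_0_right:
  assumes "N \<subseteq> carrier (free_group r)"
  shows "sphere_visits r N n 0 = real (cogrowth N n)"
proof -
  have "{x \<in> N. length x = n} = reduced_words r n \<inter> N"
    using assms by (auto simp: carrier_free_group reduced_words_def words_def)
  then show ?thesis
    by (simp add: sphere_visits_def visits_0 cogrowth_def indicator_def sum.If_cases)
qed

lemma visits_le: "visits r N k x \<le> (2 * real r) ^ k"
proof -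
  have "card {w \<in> words r k. foldr cons_red w x \<in> N} \<le> card (words r k)"
    by (intro card_mono) auto
  then have "visits r N k x \<le> real ((2 * r) ^ k)"
    unfolding visits_def card_words by (rule of_nat_mono)
  then show ?thesis by simp
qed

section \<open>The moment functional of the walk\<close>

definition moment_functional :: "(nat \<Rightarrow> real) \<Rightarrow> real poly \<Rightarrow> real" where
  "moment_functional m p = (\<Sum>i\<le>degree p. coeff p i * m i)"

lemma moment_functional_eq:
  "degree p \<le> n \<Longrightarrow> moment_functional m p = (\<Sum>i\<le>n. coeff p i * m i)"
  unfolding moment_functional_def
  by (rule sum.mono_neutral_left) (auto simp: coeff_eq_0)

lemma moment_functional_add:
  "moment_functional m (p + s) = moment_functional m p + moment_functional m s"
proof -
  let ?n = "max (degree p) (degree s)"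
  have "degree (p + s) \<le> ?n" by (rule degree_add_le_max)
  then show ?thesis
    by (simp add: moment_functional_eq[of _ ?n] algebra_simps sum.distrib)
qed

lemma moment_functional_smult: "moment_functional m (smult c p) = c * moment_functional m p"
  by (simp add: moment_functional_eq[of _ "degree p"] degree_smult_le sum_distrib_left mult_ac)

lemma moment_functional_diff:
  "moment_functional m (p - s) = moment_functional m p - moment_functional m s"
proof -
  have "p - s = p + smult (-1) s" by simp
  then show ?thesis
    by (simp only: moment_functional_add moment_functional_smult)
qed

lemma moment_functional_0 [simp]: "moment_functional m 0 = 0"
  by (simp add: moment_functional_def)

lemma moment_functional_sum:
  "moment_functional m (\<Sum>i\<in>A. f i) = (\<Sum>i\<in>A. moment_functional m (f i))"
  by (induction A rule: infinite_finite_induct) (simp_all add: moment_functional_add)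

lemma moment_functional_monom: "moment_functional m (monom c n) = c * m n"
  by (simp add: moment_functional_eq[of _ n] degree_monom_le if_distrib[of "\<lambda>x. x * _"] cong: if_cong)

text \<open>The polynomials \<open>P\<^sub>n\<close> for which \<open>P\<^sub>n(A)\<close> is the sum of the reduced words of length \<open>n\<close>; they are the
  orthogonal polynomials of the simple random walk on the \<open>(q + 1)\<close>-regular tree.\<close>

fun sphere_poly :: "real \<Rightarrow> nat \<Rightarrow> real poly" where
  "sphere_poly q 0 = 1"
| "sphere_poly q (Suc 0) = monom 1 1"
| "sphere_poly q (Suc (Suc n)) =
     monom 1 1 * sphere_poly q (Suc n) - smult (if n = 0 then q + 1 else q) (sphere_poly q n)"

text \<open>The factor \<open>x\<^sup>k\<close> makes the induction on \<open>n\<close> work: multiplication by \<open>x\<close> raises \<open>k\<close>, and the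
  recursions of both sides then coincide.\<close>

lemma moment_functional_sphere_poly:
  assumes "q = 2 * real r - 1"
  shows "moment_functional (sphere_visits r N 0) (monom 1 k * sphere_poly q n) = sphere_visits r N n k"
  using assms
proof (induction q n arbitrary: k rule: sphere_poly.induct)
  case (1 q)
  then show ?case by (simp add: moment_functional_monom)
next
  case (2 q)
  then show ?case by (simp add: moment_functional_monom mult_monom sphere_visits_0_Suc)
next
  case (3 q n)
  have "monom 1 k * sphere_poly q (Suc (Suc n)) =
      monom 1 (Suc k) * sphere_poly q (Suc n) -
      smult (if n = 0 then q + 1 else q) (monom 1 k * sphere_poly q n)"
    by (simp add: right_diff_distrib mult.assoc[symmetric] mult_monom)
  then show ?case
    using 3 by (simp add: moment_functional_diff moment_functional_smult sphere_visits_Suc)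
qed

lemma cogrowth_eq_moment_functional:
  assumes "q = 2 * real r - 1" "N \<subseteq> carrier (free_group r)"
  shows "real (cogrowth N n) = moment_functional (sphere_visits r N 0) (sphere_poly q n)"
  using moment_functional_sphere_poly[OF assms(1), of N 0 n] sphere_visits_0_right[OF assms(2)]
  by simp

lemma sphere_visits_0_left: "sphere_visits r N 0 k = visits r N k []"
  by (simp add: sphere_visits_def reduced_words_0)

definition inv_word :: "letter list \<Rightarrow> letter list" where
  "inv_word w = rev (map inv_letter w)"

lemma inv_word_inv_word [simp]: "inv_word (inv_word w) = w"
  by (simp add: inv_word_def rev_map o_def)

lemma inv_letter_eq_iff [simp]: "inv_letter a = inv_letter b \<longleftrightarrow> a = b"
  by (metis inv_letter_inv_letter)

lemma inv_word_in_words_iff: "inv_word w \<in> words r n \<longleftrightarrow> w \<in> words r n"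
proof -
  have "inv_word w \<in> words r n" if "w \<in> words r n" for w
    using that by (auto simp: inv_word_def words_def)
  then show ?thesis by (metis inv_word_inv_word)
qed

lemma reduce_word_in_carrier: "w \<in> words r n \<Longrightarrow> foldr cons_red w [] \<in> carrier (free_group r)"
  using set_foldr[of w "[]"] by (auto simp: words_def carrier_free_group reduced_foldr)

lemma reduce_inv_word:
  assumes "w \<in> words r n"
  shows "foldr cons_red (inv_word w) [] = inv\<^bsub>free_group r\<^esub> (foldr cons_red w [])"
proof -
  interpret group "free_group r" by (rule group_free_group)
  have cancel: "foldr cons_red (inv_word w) (foldr cons_red w x) = x" if "reduced x" for w x
    using that
  proof (induction w)
    case (Cons a w)
    then show ?case
      using cons_red_cancel[of "foldr cons_red w x" "inv_letter a"] reduced_foldr[of x w]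
      by (simp add: inv_word_def)
  qed (simp add: inv_word_def)
  have "foldr cons_red (inv_word w) [] \<otimes>\<^bsub>free_group r\<^esub> foldr cons_red w [] = \<one>\<^bsub>free_group r\<^esub>"
    using cancel[of "[]" w] foldr_cons_red_assoc[of "foldr cons_red w []" "inv_word w" "[]"]
    by (simp add: free_group_def reduced_foldr)
  then show ?thesis
    using assms by (intro inv_equality[symmetric] reduce_word_in_carrier) (auto simp: inv_word_in_words_iff)
qed

text \<open>A word of length \<open>i + j\<close> is \<open>u\<^sup>-\<^sup>1 v\<close> with \<open>u\<close> and \<open>v\<close> of lengths \<open>i\<close> and \<open>j\<close>, and it lies in \<open>N\<close> exactly
  when \<open>u\<close> and \<open>v\<close> lie in the same coset. So the moments form a Gram matrix.\<close>

lemma visits_add: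
  assumes N: "subgroup N (free_group r)"
  shows "visits r N (i + j) [] =
    (\<Sum>u\<in>words r i. \<Sum>v\<in>words r j.
       of_bool (foldr cons_red u [] <#\<^bsub>free_group r\<^esub> N = foldr cons_red v [] <#\<^bsub>free_group r\<^esub> N))"
proof -
  interpret group "free_group r" by (rule group_free_group)
  interpret subgroup N "free_group r" by (rule N)
  have "{w \<in> words r (i + j). foldr cons_red w [] \<in> N} =
      (\<lambda>(u, v). inv_word u @ v) `
        {(u, v) \<in> words r i \<times> words r j. foldr cons_red (inv_word u @ v) [] \<in> N}"
    (is "?A = ?f ` ?B")
  proof (intro equalityI subsetI)
    fix w assume w: "w \<in> ?A"
    then have "take i w \<in> words r i" "drop i w \<in> words r j"
      by (auto simp: words_def dest: in_set_takeD in_set_dropD)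
    then have "(inv_word (take i w), drop i w) \<in> ?B"
      using w by (simp add: inv_word_in_words_iff del: foldr_append)
    moreover have "w = ?f (inv_word (take i w), drop i w)" by simp
    ultimately show "w \<in> ?f ` ?B" by (rule rev_image_eqI)
  next
    fix w assume "w \<in> ?f ` ?B"
    then obtain u v where "u \<in> words r i" "v \<in> words r j" "w = inv_word u @ v"
      "foldr cons_red w [] \<in> N" by auto
    then show "w \<in> ?A" using inv_word_in_words_iff[of u r i] by (auto simp: words_def)
  qed
  moreover have "inj_on ?f ?B"
  proof (rule inj_onI, clarify)
    fix u v u' v' assume *: "u \<in> words r i" "u' \<in> words r i" "inv_word u @ v = inv_word u' @ v'"
    then have "length (inv_word u) = length (inv_word u')"
      using inv_word_in_words_iff[of u r i] inv_word_in_words_iff[of u' r i] by (auto simp: words_def)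
    with * show "u = u' \<and> v = v'" by (metis append_eq_append_conv inv_word_inv_word)
  qed
  ultimately have "visits r N (i + j) [] = real (card ?B)"
    by (simp add: visits_def card_image)
  also have "?B = {(u, v) \<in> words r i \<times> words r j.
      foldr cons_red u [] <#\<^bsub>free_group r\<^esub> N = foldr cons_red v [] <#\<^bsub>free_group r\<^esub> N}"
  proof -
    have "foldr cons_red (inv_word u @ v) [] \<in> N \<longleftrightarrow>
      foldr cons_red u [] <#\<^bsub>free_group r\<^esub> N = foldr cons_red v [] <#\<^bsub>free_group r\<^esub> N"
      if "u \<in> words r i" "v \<in> words r j" for u v
    proof -
      let ?u = "foldr cons_red u []" and ?v = "foldr cons_red v []"
      have c: "?u \<in> carrier (free_group r)" "?v \<in> carrier (free_group r)"
        using that by (auto intro: reduce_word_in_carrier)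
      have "foldr cons_red (inv_word u @ v) [] = inv\<^bsub>free_group r\<^esub> ?u \<otimes>\<^bsub>free_group r\<^esub> ?v"
        using foldr_cons_red_assoc[of ?v "inv_word u" "[]"] reduced_foldr[of "[]" v]
        unfolding reduce_inv_word[OF that(1), symmetric] by (simp add: free_group_def)
      moreover have "inv\<^bsub>free_group r\<^esub> ?u \<otimes>\<^bsub>free_group r\<^esub> ?v \<in> N \<longleftrightarrow>
          ?u <#\<^bsub>free_group r\<^esub> N = ?v <#\<^bsub>free_group r\<^esub> N"
      proof
        assume "inv\<^bsub>free_group r\<^esub> ?u \<otimes>\<^bsub>free_group r\<^esub> ?v \<in> N"
        then have "?u \<otimes>\<^bsub>free_group r\<^esub> (inv\<^bsub>free_group r\<^esub> ?u \<otimes>\<^bsub>free_group r\<^esub> ?v)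
            \<in> ?u <#\<^bsub>free_group r\<^esub> N"
          by (auto simp: l_coset_def)
        then have "?v \<in> ?u <#\<^bsub>free_group r\<^esub> N"
          using c by (simp add: m_assoc[symmetric])
        then show "?u <#\<^bsub>free_group r\<^esub> N = ?v <#\<^bsub>free_group r\<^esub> N"
          using c(1) N by (rule l_repr_independence)
      next
        assume "?u <#\<^bsub>free_group r\<^esub> N = ?v <#\<^bsub>free_group r\<^esub> N"
        moreover have "?v \<in> ?v <#\<^bsub>free_group r\<^esub> N"
          using c one_closed by (force simp: l_coset_def)
        ultimately obtain h where "h \<in> N" "?v = ?u \<otimes>\<^bsub>free_group r\<^esub> h"
          by (auto simp: l_coset_def)
        then show "inv\<^bsub>free_group r\<^esub> ?u \<otimes>\<^bsub>free_group r\<^esub> ?v \<in> N"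
          using c by (simp add: m_assoc[symmetric])
      qed
      ultimately show ?thesis by simp
    qed
    then show ?thesis by auto
  qed
  also have "real (card \<dots>) = (\<Sum>(u, v)\<in>words r i \<times> words r j.
      of_bool (foldr cons_red u [] <#\<^bsub>free_group r\<^esub> N = foldr cons_red v [] <#\<^bsub>free_group r\<^esub> N))"
    by (simp add: of_bool_def sum.If_cases case_prod_unfold Int_def conj_assoc mem_Times_iff)
  finally show ?thesis by (simp only: sum.cartesian_product)
qed

text \<open>By the Gram structure, \<open>L(p\<^sup>2)\<close> is the sum over all cosets \<open>c\<close> of the squares of
  \<open>\<Sum>\<^sub>u coeff p \<bar>u\<bar>\<close>, where \<open>u\<close> runs over the words that end in \<open>c\<close>.\<close>

lemma moment_functional_square_nonneg:
  assumes "subgroup N (free_group r)"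
  shows "moment_functional (sphere_visits r N 0) (p * p) \<ge> 0"
proof -
  define cl where "cl u = foldr cons_red u [] <#\<^bsub>free_group r\<^esub> N" for u
  define d where "d = degree p"
  define U where "U = (SIGMA i:{..d}. words r i)"
  define cs where "cs = (\<lambda>(i, u). cl u) ` U"
  define s where "s c = (\<Sum>(i, u)\<in>U. coeff p i * of_bool (cl u = c))" for c
  have fin: "finite U" "finite cs" by (auto simp: U_def cs_def)
  have "p * p = (\<Sum>i\<le>d. monom (coeff p i) i) * (\<Sum>j\<le>d. monom (coeff p j) j)"
    by (simp add: d_def poly_as_sum_of_monoms)
  also have "\<dots> = (\<Sum>i\<le>d. \<Sum>j\<le>d. monom (coeff p i * coeff p j) (i + j))"
    by (simp add: sum_product mult_monom)
  finally have "moment_functional (sphere_visits r N 0) (p * p) =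
      (\<Sum>i\<le>d. \<Sum>j\<le>d. coeff p i * coeff p j * visits r N (i + j) [])"
    by (simp add: moment_functional_sum moment_functional_monom sphere_visits_0_left)
  also have "\<dots> = (\<Sum>i\<le>d. \<Sum>j\<le>d. \<Sum>u\<in>words r i. \<Sum>v\<in>words r j.
      coeff p i * coeff p j * of_bool (cl u = cl v))"
    by (simp only: visits_add[OF assms] cl_def sum_distrib_left)
  also have "\<dots> = (\<Sum>i\<le>d. \<Sum>u\<in>words r i. \<Sum>j\<le>d. \<Sum>v\<in>words r j.
      coeff p i * coeff p j * of_bool (cl u = cl v))"
    by (intro sum.cong refl sum.swap)
  also have "\<dots> = (\<Sum>(i, u)\<in>U. \<Sum>(j, v)\<in>U. coeff p i * coeff p j * of_bool (cl u = cl v))"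
  proof -
    have Sig: "(\<Sum>i\<le>d. \<Sum>u\<in>words r i. g i u) = (\<Sum>(i, u)\<in>U. g i u)" for g :: "nat \<Rightarrow> letter list \<Rightarrow> real"
      unfolding U_def by (rule sum.Sigma) auto
    show ?thesis by (simp only: Sig)
  qed
  also have "\<dots> = (\<Sum>(i, u)\<in>U. \<Sum>(j, v)\<in>U. \<Sum>c\<in>cs.
      (coeff p i * of_bool (cl u = c)) * (coeff p j * of_bool (cl v = c)))"
  proof -
    have "coeff p i * coeff p j * of_bool (cl u = cl v) = (\<Sum>c\<in>cs.
      (coeff p i * of_bool (cl u = c)) * (coeff p j * of_bool (cl v = c)))"
      if "(i, u) \<in> U" for i j u v
    proof -
      have "cl u \<in> cs" using that by (force simp: cs_def)
      have "(\<Sum>c\<in>cs. (coeff p i * of_bool (cl u = c)) * (coeff p j * of_bool (cl v = c))) =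
        (\<Sum>c\<in>{cl u}. (coeff p i * of_bool (cl u = c)) * (coeff p j * of_bool (cl v = c)))"
        by (rule sum.mono_neutral_right) (use fin \<open>cl u \<in> cs\<close> in auto)
      then show ?thesis by (auto simp: of_bool_def)
    qed
    then show ?thesis by (auto intro!: sum.cong)
  qed
  also have "\<dots> = (\<Sum>c\<in>cs. s c * s c)"
    unfolding s_def sum_product case_prod_unfold
    by (subst (2) sum.swap, subst sum.swap, simp)
  also have "\<dots> \<ge> 0" by (intro sum_nonneg) auto
  finally show ?thesis .
qed

section \<open>Existence of the cogrowth exponent\<close>

text \<open>For \<open>x\<close> and \<open>y\<close> in \<open>N\<close> the element \<open>x a y a\<^sup>-\<^sup>1\<close> is again in \<open>N\<close>. Only three letters \<open>a\<close> can cause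
  a cancellation at one of the three joints, and \<open>r \<ge> 2\<close> provides four letters. The words \<open>x\<close> and \<open>y\<close>
  can be read off from the product, because their lengths are known.\<close>

lemma cogrowth_supermultiplicative:
  assumes N: "N \<lhd> free_group r" and r: "r \<ge> 2" and k: "k \<ge> 1"
  shows "cogrowth N n * cogrowth N k \<le> cogrowth N (n + k + 2)"
proof -
  interpret group "free_group r" by (rule group_free_group)
  interpret normal N "free_group r" by (rule N)
  define A where "A n = {x \<in> N. length x = n}" for n
  have finA: "finite (A n)" for n
    by (rule finite_subset[OF _ finite_free_group_sphere[of r n]]) (use subset in \<open>auto simp: A_def\<close>)
  have "\<exists>a\<in>letters r. reduced (x @ a # y @ [inv_letter a])"
    if xy: "x \<in> A n" "y \<in> A k" for x y
  proof -
    \<comment> \<open>An empty \<open>x\<close> imposes no condition; then \<open>last x\<close> is an arbitrary letter and does no harm.\<close>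
    define B where "B = {inv_letter (last x), inv_letter (hd y), last y}"
    have "card B \<le> 3"
      using card_length[of "[inv_letter (last x), inv_letter (hd y), last y]"] by (simp add: B_def)
    moreover have "card (letters r) \<ge> 4" using r by (simp add: card_letters)
    ultimately have "\<not> letters r \<subseteq> B"
      using card_mono[of B "letters r"] by (auto simp: B_def)
    then obtain a where a: "a \<in> letters r" "a \<notin> B" by blast
    have "x \<in> carrier (free_group r)" "y \<in> carrier (free_group r)"
      using xy by (simp_all add: A_def)
    then have "reduced x" "reduced y" "y \<noteq> []"
      using xy(2) k by (auto simp: A_def carrier_free_group)
    then have "reduced (x @ a # y @ [inv_letter a])"
      using a(2) by (auto simp: reduced_append_iff reduced_Cons_iff B_def)
    with a(1) show ?thesis by blast
  qed
  then obtain f where f: "\<And>x y. x \<in> A n \<Longrightarrow> y \<in> A k \<Longrightarrow>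
      f x y \<in> letters r \<and> reduced (x @ f x y # y @ [inv_letter (f x y)])" by metis
  define g where "g = (\<lambda>(x, y). x @ f x y # y @ [inv_letter (f x y)])"
  have "g ` (A n \<times> A k) \<subseteq> A (n + k + 2)"
  proof clarify
    fix x y assume xy: "x \<in> A n" "y \<in> A k"
    define a where "a = f x y"
    have a: "a \<in> letters r" and red: "reduced (x @ a # y @ [inv_letter a])"
      using f[OF xy] by (auto simp: a_def)
    have c: "[a] \<in> carrier (free_group r)" using a by (simp add: carrier_free_group)
    have inv: "inv\<^bsub>free_group r\<^esub> [a] = [inv_letter a]"
      using a by (intro inv_equality) (auto simp: free_group_def letters_def inv_letter_def)
    have xN: "x \<in> N" "y \<in> N" using xy by (auto simp: A_def)
    have conj: "[a] \<otimes>\<^bsub>free_group r\<^esub> y \<otimes>\<^bsub>free_group r\<^esub> inv\<^bsub>free_group r\<^esub> [a] \<in> N"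
      using c xN by (intro inv_op_closed2) auto
    have "x \<otimes>\<^bsub>free_group r\<^esub> ([a] \<otimes>\<^bsub>free_group r\<^esub> (y \<otimes>\<^bsub>free_group r\<^esub> [inv_letter a])) \<in> N"
    proof -
      have c': "[inv_letter a] \<in> carrier (free_group r)" using a by (simp add: carrier_free_group)
      have "y \<in> carrier (free_group r)" using xN subset by blast
      then have "[a] \<otimes>\<^bsub>free_group r\<^esub> (y \<otimes>\<^bsub>free_group r\<^esub> [inv_letter a]) =
          [a] \<otimes>\<^bsub>free_group r\<^esub> y \<otimes>\<^bsub>free_group r\<^esub> inv\<^bsub>free_group r\<^esub> [a]"
        using c c' inv by (simp add: m_assoc)
      then show ?thesis using conj xN by simp
    qed
    also have "y \<otimes>\<^bsub>free_group r\<^esub> [inv_letter a] = y @ [inv_letter a]"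
      using red by (simp add: free_group_def foldr_cons_red_append reduced_append_iff reduced_Cons_iff)
    also have "[a] \<otimes>\<^bsub>free_group r\<^esub> (y @ [inv_letter a]) = a # y @ [inv_letter a]"
      using red foldr_cons_red_append[of "[a]" "y @ [inv_letter a]"]
      by (simp add: free_group_def reduced_append_iff[of x])
    also have "x \<otimes>\<^bsub>free_group r\<^esub> (a # y @ [inv_letter a]) = x @ a # y @ [inv_letter a]"
      using red by (simp add: free_group_def foldr_cons_red_append)
    finally show "g (x, y) \<in> A (n + k + 2)"
      using xy by (simp add: g_def a_def A_def)
  qed
  moreover have "inj_on g (A n \<times> A k)"
  proof (rule inj_onI, clarify)
    fix x y x' y' assume xy: "x \<in> A n" "x' \<in> A n" and "g (x, y) = g (x', y')"
    then have eq: "x @ (f x y # y @ [inv_letter (f x y)]) = x' @ (f x' y' # y' @ [inv_letter (f x' y')])"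
      by (simp only: g_def prod.case)
    have "length x = length x'" using xy by (simp add: A_def)
    from append_eq_append_conv[THEN iffD1, OF disjI1, OF this eq]
    show "x = x' \<and> y = y'" by simp
  qed
  ultimately have "card (A n \<times> A k) \<le> card (A (n + k + 2))"
    using card_inj_on_le finA by blast
  then show ?thesis by (simp add: card_cartesian_product cogrowth_def A_def)
qed

text \<open>Fekete's lemma: a superadditive sequence grows like its best linear lower bound. Superadditivity
  is available only from some index on, so the remainder of the division by \<open>p\<close> is taken in
  \<open>{p..<2p}\<close> instead of \<open>{0..<p}\<close>.\<close>

lemma superadditive_convergent:
  fixes c :: "nat \<Rightarrow> real" and K :: real
  assumes sup: "\<And>m n. m \<ge> k0 \<Longrightarrow> n \<ge> k0 \<Longrightarrow> c (m + n) \<ge> c m + c n"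
    and nonneg: "\<And>n. n \<ge> k0 \<Longrightarrow> c n \<ge> 0"
    and bound: "\<And>n. n \<ge> k0 \<Longrightarrow> c n \<le> K * n"
  shows "convergent (\<lambda>n. c n / n)"
proof -
  define S where "S = (\<lambda>n. c n / real n) ` {max 1 k0..}"
  have bdd: "bdd_above S"
    by (rule bdd_aboveI[where M = K]) (use bound in \<open>auto simp: S_def field_simps\<close>)
  have ne: "S \<noteq> {}" by (auto simp: S_def)
  have mult: "c (t * p + s) \<ge> real t * c p" if "p \<ge> k0" "s \<ge> k0" for t p s
  proof (induction t)
    case 0
    then show ?case using nonneg that by simp
  next
    case (Suc t)
    have "c (p + (t * p + s)) \<ge> c p + c (t * p + s)" using that by (intro sup) auto
    then show ?case using Suc by (simp add: algebra_simps)
  qed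
  have "(\<lambda>n. c n / real n) \<longlonglongrightarrow> Sup S"
  proof (rule LIMSEQ_I)
    fix e :: real assume e: "e > 0"
    then obtain x where "x \<in> S" "x > Sup S - e / 2"
      using less_cSup_iff[OF ne bdd, of "Sup S - e / 2"] by auto
    then obtain p where p: "p \<ge> 1" "p \<ge> k0" "c p / p > Sup S - e / 2" by (auto simp: S_def)
    \<comment> \<open>Writing \<open>n = t p + s\<close> with \<open>s \<le> 2 p\<close> loses at most \<open>2 c\<^sub>p\<close> against \<open>(n/p) c\<^sub>p\<close>.\<close>
    have lim: "(\<lambda>n. c p / p - (2 * c p) / real n) \<longlonglongrightarrow> c p / p"
      by real_asymp
    have "eventually (\<lambda>n. c p / p - (2 * c p) / real n > c p / p - e / 2) sequentially"
      by (rule order_tendstoD[OF lim]) (use e in auto)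
    then obtain n0 where n0: "\<And>n. n \<ge> n0 \<Longrightarrow> c p / p - (2 * c p) / real n > c p / p - e / 2"
      by (auto simp: eventually_sequentially)
    show "\<exists>no. \<forall>n\<ge>no. norm (c n / real n - Sup S) < e"
    proof (intro exI allI impI)
      fix n assume n: "n \<ge> max n0 (max k0 p + p)"
      define t where "t = (n - p) div p"
      define s where "s = (n - p) mod p + p"
      have ns: "n = t * p + s" using n by (simp add: t_def s_def)
      have "s \<le> 2 * p" using p(1) mod_less_divisor[of p "n - p"] by (simp add: s_def)
      have "c n \<ge> real t * c p" unfolding ns by (rule mult) (use p in \<open>auto simp: s_def\<close>)
      moreover have "real t * c p \<ge> (real n - 2 * real p) / p * c p"
      proof (rule mult_right_mono)
        have "real n \<le> real t * real p + 2 * real p" using \<open>s \<le> 2 * p\<close> ns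
          by (metis of_nat_add of_nat_mult of_nat_le_iff add_left_mono of_nat_numeral)
        then show "(real n - 2 * real p) / p \<le> real t" using p(1) by (simp add: field_simps)
        show "0 \<le> c p" using nonneg p by simp
      qed
      ultimately have "c n / n \<ge> ((real n - 2 * real p) / p * c p) / n"
        by (intro divide_right_mono) auto
      also have "((real n - 2 * real p) / p * c p) / n = c p / p - (2 * c p) / n"
        using n p(1) by (simp add: field_simps)
      finally have "c n / n > Sup S - e"
        using n0[of n] n p(3) by simp
      moreover have "c n / n \<le> Sup S"
        by (rule cSup_upper[OF _ bdd]) (use n p in \<open>auto simp: S_def\<close>)
      ultimately show "norm (c n / real n - Sup S) < e" by simp
    qed
  qed
  then show ?thesis by (auto simp: convergent_def)
qed

lemma cogrowth_le:
  assumes "N \<subseteq> carrier (free_group r)"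
  shows "real (cogrowth N n) \<le> (2 * real r) ^ n"
proof -
  have "{x \<in> N. length x = n} \<subseteq> words r n"
    using assms by (auto simp: carrier_free_group words_def)
  then have "cogrowth N n \<le> (2 * r) ^ n"
    unfolding cogrowth_def card_words[symmetric] by (intro card_mono) auto
  then have "real (cogrowth N n) \<le> real ((2 * r) ^ n)" by (rule of_nat_mono)
  then show ?thesis by simp
qed

text \<open>With \<open>a\<^sub>k = \<gamma>\<^bsub>2k\<^esub>\<close>, supermultiplicativity reads \<open>a\<^sub>k a\<^sub>l \<le> a\<^bsub>k+l+1\<^esub>\<close>, so Fekete's lemma applies to
  \<open>c\<^sub>k = ln a\<^bsub>k-1\<^esub>\<close>. The case \<open>k = 0\<close> shows that \<open>a\<close> is monotone from \<open>a\<^sub>1\<close> on, hence \<open>c\<close> is eventually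
  nonnegative unless \<open>N\<close> has no nonempty words of even length.\<close>

lemma cogrowth_exponent_tendsto:
  assumes N: "N \<lhd> free_group r" and r: "r \<ge> 2"
  shows "(\<lambda>n. root (2 * n) (real (cogrowth N (2 * n)))) \<longlonglongrightarrow> cogrowth_exponent N"
proof -
  interpret group "free_group r" by (rule group_free_group)
  interpret normal N "free_group r" by (rule N)
  define a where "a n = cogrowth N (2 * n)" for n
  have finA: "finite {x \<in> N. length x = n}" for n
    by (rule finite_subset[OF _ finite_free_group_sphere[of r n]]) (use subset in auto)
  have N0: "cogrowth N 0 = 1"
  proof -
    have "{x \<in> N. length x = 0} = {[]}" using one_closed by (auto simp: free_group_def)
    then show ?thesis by (simp add: cogrowth_def)
  qed
  have super: "a n * a k \<le> a (n + k + 1)" if "k \<ge> 1" for n k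
    using cogrowth_supermultiplicative[OF N r, of "2 * k" "2 * n"] that
    by (simp add: a_def algebra_simps)
  have mono: "a k \<le> a (Suc k)" if "k \<ge> 1" for k
    using super[of k 0] that N0 by (simp add: a_def)
  have "convergent (\<lambda>n. root (2 * n) (real (a n)))"
  proof (cases "\<exists>k\<ge>1. a k > 0")
    case False
    then have "eventually (\<lambda>n. root (2 * n) (real (a n)) = 0) sequentially"
      by (intro eventually_mono[OF eventually_ge_at_top[of 1]]) auto
    then have "(\<lambda>n. root (2 * n) (real (a n))) \<longlonglongrightarrow> 0" by (rule tendsto_eventually)
    then show ?thesis by (rule convergentI)
  next
    case True
    then obtain k0 where k0: "k0 \<ge> 1" "a k0 > 0" by blast
    have pos: "a k \<ge> 1" if "k \<ge> k0" for k
      using that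
    proof (induction k rule: dec_induct)
      case (step k)
      then show ?case using mono[of k] k0 by simp
    qed (use k0 in simp)
    define c where "c n = ln (real (a (n - 1)))" for n
    have "convergent (\<lambda>n. c n / n)"
    proof (rule superadditive_convergent[of "Suc k0" c "2 * ln (2 * real r)"])
      fix m n assume mn: "Suc k0 \<le> m" "Suc k0 \<le> n"
      then have "a (m - 1) * a (n - 1) \<le> a (m + n - 1)"
        using super[of "n - 1" "m - 1"] k0 by (cases m; cases n) auto
      then have "real (a (m - 1)) * real (a (n - 1)) \<le> real (a (m + n - 1))"
        by (metis of_nat_le_iff of_nat_mult)
      moreover have ge: "a (m - 1) \<ge> 1" "a (n - 1) \<ge> 1" "a (m + n - 1) \<ge> 1"
        by (rule pos; use mn in linarith)+
      ultimately have "ln (real (a (m - 1)) * real (a (n - 1))) \<le> ln (real (a (m + n - 1)))"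
        by (subst ln_le_cancel_iff) auto
      then show "c m + c n \<le> c (m + n)"
        using ge by (subst (asm) ln_mult_pos) (auto simp: c_def)
    next
      fix n assume n: "Suc k0 \<le> n"
      then have p: "a (n - 1) \<ge> 1" using pos by simp
      then show "0 \<le> c n" by (simp add: c_def)
      have "real (a (n - 1)) \<le> (2 * real r) ^ (2 * (n - 1))"
        unfolding a_def by (rule cogrowth_le[OF subset])
      also have "\<dots> \<le> (2 * real r) ^ (2 * n)" using r by (intro power_increasing) auto
      finally have "c n \<le> ln ((2 * real r) ^ (2 * n))" using p r by (simp add: c_def)
      also have "\<dots> = real (2 * n) * ln (2 * real r)" by (rule ln_realpow)
      finally show "c n \<le> 2 * ln (2 * real r) * real n" by (simp add: mult_ac)
    qed
    then obtain l where l: "(\<lambda>n. c n / n) \<longlonglongrightarrow> l" by (auto simp: convergent_def)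
    have "(\<lambda>n. c (Suc n) / Suc n * (Suc n / (2 * n))) \<longlonglongrightarrow> l * (1 / 2)"
    proof (rule tendsto_mult)
      show "(\<lambda>n. c (Suc n) / Suc n) \<longlonglongrightarrow> l" using l by (rule LIMSEQ_Suc)
      show "(\<lambda>n. Suc n / (2 * n)) \<longlonglongrightarrow> 1 / (2::real)" by real_asymp
    qed
    then have "(\<lambda>n. exp (c (Suc n) / Suc n * (Suc n / (2 * n)))) \<longlonglongrightarrow> exp (l * (1 / 2))"
      by (rule tendsto_exp)
    moreover have "eventually (\<lambda>n. exp (c (Suc n) / Suc n * (Suc n / (2 * n))) =
        root (2 * n) (real (a n))) sequentially"
      using eventually_ge_at_top[of k0]
    proof eventually_elim
      case (elim n)
      then have "a n \<ge> 1" "n \<ge> 1" using pos k0 by auto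
      have "c (Suc n) / Suc n * (Suc n / (2 * n)) = ln (real (a n)) / (2 * n)"
        by (simp add: c_def del: of_nat_Suc)
      then show ?case
        using \<open>a n \<ge> 1\<close> \<open>n \<ge> 1\<close> by (simp only: root_powr_inverse powr_def) simp
    qed
    ultimately have "(\<lambda>n. root (2 * n) (real (a n))) \<longlonglongrightarrow> exp (l * (1 / 2))"
      by (rule Lim_transform_eventually)
    then show ?thesis by (rule convergentI)
  qed
  then show ?thesis by (simp add: cogrowth_exponent_def a_def convergent_LIMSEQ_iff)
qed

section \<open>From the growth of reduced words to the growth of all words\<close>

text \<open>The weight \<open>\<psi>\<close> satisfies \<open>\<psi>\<^bsub>n+1\<^esub> + q \<psi>\<^bsub>n-1\<^esub> = \<Lambda> \<psi>\<^sub>n\<close> because \<open>\<alpha>\<close> and \<open>q/\<alpha>\<close> are the roots of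
  \<open>t\<^sup>2 - \<Lambda> t + q\<close>. The value \<open>\<psi>\<^sub>0 = 2q/(q + 1)\<close> compensates the larger factor \<open>q + 1\<close> at \<open>n = 1\<close> and is at
  least \<open>1\<close>, which is what the step at \<open>n = 0\<close> asks for. Parity of \<open>n + k\<close> is
  preserved by the recursion, so only even cogrowth coefficients enter.\<close>

lemma even_sphere_visits_le:
  fixes \<alpha> q C :: real
  assumes "N \<subseteq> carrier (free_group r)" "r \<ge> 1" "\<alpha> > 0" "C \<ge> 0"
    and q: "q = 2 * real r - 1"
    and gr: "\<And>n. even n \<Longrightarrow> real (cogrowth N n) \<le> C * \<alpha> ^ n"
  defines "\<Lambda> \<equiv> \<alpha> + q / \<alpha>"
  defines "\<psi> \<equiv> \<lambda>n. if n = 0 then 2 * q / (q + 1) else \<alpha> ^ n + (q / \<alpha>) ^ n"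
  shows "even (n + k) \<Longrightarrow> sphere_visits r N n k \<le> C * \<psi> n * \<Lambda> ^ k"
proof (induction k arbitrary: n)
  case 0
  have "q \<ge> 1" using assms by simp
  then have "\<alpha> ^ n \<le> \<psi> n" using \<open>\<alpha> > 0\<close> by (auto simp: \<psi>_def field_simps)
  then have "C * \<alpha> ^ n \<le> C * \<psi> n" using \<open>C \<ge> 0\<close> by (rule mult_left_mono)
  then show ?case using gr[of n] 0 sphere_visits_0_right[OF assms(1)] by simp
next
  case (Suc k)
  have q1: "q \<ge> 1" using assms by simp
  have L: "\<Lambda> \<ge> 0" using \<open>\<alpha> > 0\<close> q1 by (simp add: \<Lambda>_def)
  show ?case
  proof (cases "n = 0")
    case True
    have "\<psi> 1 \<le> \<psi> 0 * \<Lambda>"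
    proof -
      have "1 * \<Lambda> \<le> 2 * q / (q + 1) * \<Lambda>"
        using q1 L by (intro mult_right_mono) (auto simp: field_simps)
      then show ?thesis by (simp add: \<psi>_def \<Lambda>_def)
    qed
    then have "C * \<Lambda> ^ k * \<psi> 1 \<le> C * \<Lambda> ^ k * (\<psi> 0 * \<Lambda>)"
      using \<open>C \<ge> 0\<close> L by (intro mult_left_mono) auto
    moreover have "sphere_visits r N 1 k \<le> C * \<psi> 1 * \<Lambda> ^ k"
      by (rule Suc.IH) (use Suc.prems True in auto)
    ultimately show ?thesis
      unfolding True sphere_visits_0_Suc by (simp add: mult_ac)
  next
    case False
    define c where "c = (if n = 1 then 2 * real r else 2 * real r - 1)"
    have c: "c \<ge> 0" "c = (if n = 1 then q + 1 else q)" using q1 by (auto simp: c_def q)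
    have eig: "\<psi> (Suc n) + c * \<psi> (n - 1) = \<psi> n * \<Lambda>"
    proof (cases "n = 1")
      case True
      have "(q + 1) * (2 * q / (q + 1)) = 2 * q" using q1 by simp
      then show ?thesis using \<open>\<alpha> > 0\<close> q1 True
        by (simp add: \<psi>_def c \<Lambda>_def power2_eq_square algebra_simps)
    next
      case False
      then obtain m where n: "n = Suc (Suc m)"
        using \<open>n \<noteq> 0\<close> by (metis One_nat_def not0_implies_Suc)
      show ?thesis using \<open>\<alpha> > 0\<close> q1
        by (simp add: \<psi>_def c \<Lambda>_def n field_simps)
    qed
    have "sphere_visits r N n (Suc k) = sphere_visits r N (Suc n) k + c * sphere_visits r N (n - 1) k"
      using False by (simp add: sphere_visits_Suc c_def)
    also have "\<dots> \<le> C * \<psi> (Suc n) * \<Lambda> ^ k + c * (C * \<psi> (n - 1) * \<Lambda> ^ k)"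
      using False Suc.prems c by (intro add_mono mult_left_mono Suc.IH) auto
    also have "\<dots> = C * (\<psi> (Suc n) + c * \<psi> (n - 1)) * \<Lambda> ^ k" by (simp add: algebra_simps)
    finally show ?thesis unfolding eig by (simp add: mult_ac)
  qed
qed

lemma even_cogrowth_le:
  assumes lim: "(\<lambda>n. root (2 * n) (real (cogrowth N (2 * n)))) \<longlonglongrightarrow> \<gamma>"
    and \<alpha>: "\<alpha> > \<gamma>" "\<alpha> > 0"
  obtains C where "C \<ge> 0" "\<And>n. even n \<Longrightarrow> real (cogrowth N n) \<le> C * \<alpha> ^ n"
proof -
  have "eventually (\<lambda>n. root (2 * n) (real (cogrowth N (2 * n))) < \<alpha>) sequentially"
    using lim \<alpha>(1) by (rule order_tendstoD)
  then obtain n0 where n0: "\<And>n. n \<ge> n0 \<Longrightarrow> root (2 * n) (real (cogrowth N (2 * n))) < \<alpha>"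
    by (auto simp: eventually_sequentially)
  define C where "C = 1 + (\<Sum>n\<le>n0. real (cogrowth N (2 * n)) / \<alpha> ^ (2 * n))"
  have C: "C \<ge> 1" using \<alpha> by (auto simp: C_def intro!: sum_nonneg)
  have "real (cogrowth N (2 * n)) \<le> C * \<alpha> ^ (2 * n)" for n
  proof (cases "n \<le> n0")
    case True
    have "real (cogrowth N (2 * n)) / \<alpha> ^ (2 * n) \<le>
        (\<Sum>n\<le>n0. real (cogrowth N (2 * n)) / \<alpha> ^ (2 * n))"
      by (rule member_le_sum) (use True \<alpha> in auto)
    then have "real (cogrowth N (2 * n)) / \<alpha> ^ (2 * n) \<le> C" by (simp add: C_def)
    then show ?thesis using \<alpha> by (simp add: field_simps)
  next
    case False
    then have "real (cogrowth N (2 * n)) = root (2 * n) (real (cogrowth N (2 * n))) ^ (2 * n)"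
      by (intro real_root_pow_pos2[symmetric]) auto
    also have "\<dots> \<le> \<alpha> ^ (2 * n)"
      using n0[of n] False by (intro power_mono real_root_ge_zero) auto
    also have "\<dots> \<le> C * \<alpha> ^ (2 * n)"
      using C \<alpha> mult_right_mono[of 1 C "\<alpha> ^ (2 * n)"] by simp
    finally show ?thesis .
  qed
  then have "real (cogrowth N n) \<le> C * \<alpha> ^ n" if "even n" for n
    using that by (auto elim!: evenE)
  then show thesis using C by (intro that[of C]) auto
qed

lemma visits_growth:
  assumes N: "N \<lhd> free_group r" and r: "r \<ge> 2" and q: "q = 2 * real r - 1"
    and g: "g > 0" "g \<ge> cogrowth_exponent N" and e: "e > 0"
  shows "\<exists>C. \<forall>n. visits r N (2 * n) [] \<le> C * (g + q / g + e) ^ (2 * n)"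
proof -
  define \<alpha> where "\<alpha> = g + e"
  have \<alpha>: "\<alpha> > 0" "\<alpha> > cogrowth_exponent N" using g e by (auto simp: \<alpha>_def)
  obtain C where C: "C \<ge> 0" "\<And>n. even n \<Longrightarrow> real (cogrowth N n) \<le> C * \<alpha> ^ n"
    using even_cogrowth_le[OF cogrowth_exponent_tendsto[OF N r] \<alpha>(2,1)] by blast
  have q1: "q \<ge> 1" using q r by simp
  have sub: "N \<subseteq> carrier (free_group r)"
    using N by (simp add: normal_imp_subgroup subgroup.subset)
  have \<Lambda>: "\<alpha> + q / \<alpha> \<le> g + q / g + e" "0 \<le> \<alpha> + q / \<alpha>"
  proof -
    have "q / \<alpha> \<le> q / g" using g e q1 by (intro divide_left_mono) (auto simp: \<alpha>_def)
    then show "\<alpha> + q / \<alpha> \<le> g + q / g + e" by (simp add: \<alpha>_def)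
    show "0 \<le> \<alpha> + q / \<alpha>" using \<alpha> q1 by simp
  qed
  have "visits r N (2 * n) [] \<le> C * (2 * q / (q + 1)) * (g + q / g + e) ^ (2 * n)" for n
  proof -
    have "visits r N (2 * n) [] \<le> C * (2 * q / (q + 1)) * (\<alpha> + q / \<alpha>) ^ (2 * n)"
      using even_sphere_visits_le[OF sub _ \<alpha>(1) C(1) q C(2), of 0 "2 * n"] r
      by (simp add: sphere_visits_0_left)
    also have "\<dots> \<le> C * (2 * q / (q + 1)) * (g + q / g + e) ^ (2 * n)"
      using C(1) q1 \<Lambda> by (intro mult_left_mono power_mono) auto
    finally show ?thesis .
  qed
  then show ?thesis by blast
qed

section \<open>Discrete approximation of a positive functional\<close>

text \<open>A functional on polynomials that behaves like integration against a positive measure. The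
  growth condition on the even moments says that this measure lives on \<open>[-R, R]\<close>.\<close>

locale positive_functional =
  fixes L :: "real poly \<Rightarrow> real" and R :: real
  assumes add: "L (p + s) = L p + L s"
    and smult: "L (smult c p) = c * L p"
    and square: "L (p * p) \<ge> 0"
    and R_pos: "R > 0"
    and growth: "\<And>e. e > 0 \<Longrightarrow> \<exists>C. \<forall>n. L (monom 1 (2 * n)) \<le> C * (R + e) ^ (2 * n)"
begin

lemma zero: "L 0 = 0"
  using smult[of 0 0] by simp

lemma diff: "L (p - s) = L p - L s"
  using add[of "p - s" s] by simp

lemma sum: "L (\<Sum>i\<in>A. f i) = (\<Sum>i\<in>A. L (f i))"
  by (induction A rule: infinite_finite_induct) (simp_all add: add zero)

lemma Cauchy_Schwarz: "(L (p * s))\<^sup>2 \<le> L (p * p) * L (s * s)"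
proof -
  have expand: "L (p * p) + 2 * t * L (p * s) + t\<^sup>2 * L (s * s) \<ge> 0" for t
  proof -
    have "(p + smult t s) * (p + smult t s) =
        p * p + smult t (p * s) + smult t (p * s) + smult (t * t) (s * s)"
      by (simp only: distrib_left distrib_right smult_add_right mult_smult_left mult_smult_right
          smult_smult mult.commute[of s p] add_ac)
    then show ?thesis
      using square[of "p + smult t s"]
      by (simp only: add smult) (simp add: power2_eq_square algebra_simps)
  qed
  show ?thesis
  proof (cases "L (s * s) = 0")
    case True
    have "L (p * s) = 0"
    proof (rule ccontr)
      assume nz: "L (p * s) \<noteq> 0"
      show False
        using expand[of "- (L (p * p) + 1) / (2 * L (p * s))"] nz True by (simp add: field_simps)
    qed
    then show ?thesis using True by simp
  next
    case False
    then have pos: "L (s * s) > 0" using square[of s] by simp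
    show ?thesis
      using expand[of "- L (p * s) / L (s * s)"] pos
      by (simp add: field_simps power2_eq_square)
  qed
qed

text \<open>An odd moment lies between its two even neighbours by the Cauchy-Schwarz inequality.\<close>

lemma growth_all:
  assumes "e > 0"
  shows "\<exists>C. \<forall>n. \<bar>L (monom 1 n)\<bar> \<le> C * (R + e) ^ n"
proof -
  obtain C where C: "\<And>n. L (monom 1 (2 * n)) \<le> C * (R + e) ^ (2 * n)"
    using growth[OF assms] by blast
  define B where "B = R + e"
  have B: "B > 0" using assms R_pos by (simp add: B_def)
  have ev: "0 \<le> L (monom 1 (2 * n))" for n
    using square[of "monom 1 n"] by (simp add: mult_monom mult_2)
  have "C \<ge> 0" using C[of 0] ev[of 0] by simp
  have "\<bar>L (monom 1 n)\<bar> \<le> C * B ^ n" for n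
  proof (rule power2_le_imp_le)
    have "(L (monom 1 n))\<^sup>2 = (L (monom 1 (n div 2) * monom 1 (n - n div 2)))\<^sup>2"
      by (simp add: mult_monom)
    also have "\<dots> \<le> L (monom 1 (2 * (n div 2))) * L (monom 1 (2 * (n - n div 2)))"
      using Cauchy_Schwarz[of "monom 1 (n div 2)" "monom 1 (n - n div 2)"]
      by (simp add: mult_monom mult_2)
    also have "\<dots> \<le> (C * B ^ (2 * (n div 2))) * (C * B ^ (2 * (n - n div 2)))"
      unfolding B_def by (intro mult_mono C ev) (use \<open>C \<ge> 0\<close> B in \<open>auto simp: B_def\<close>)
    also have "\<dots> = (C * B ^ n)\<^sup>2"
    proof -
      have "B ^ (2 * (n div 2)) * B ^ (2 * (n - n div 2)) = B ^ (n + n)"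
        unfolding power_add[symmetric] by (rule arg_cong[where f = "\<lambda>k. B ^ k"]) simp
      then show ?thesis by (simp add: power2_eq_square power_add mult_ac)
    qed
    finally show "\<bar>L (monom 1 n)\<bar>\<^sup>2 \<le> (C * B ^ n)\<^sup>2" by simp
    show "0 \<le> C * B ^ n" using \<open>C \<ge> 0\<close> B by simp
  qed
  then show ?thesis by (intro exI[of _ C]) (simp add: B_def)
qed

lemma growth_poly:
  assumes "e > 0"
  shows "\<exists>C. \<forall>n. \<bar>L (monom 1 n * s)\<bar> \<le> C * (R + e) ^ n"
proof -
  obtain C where C: "\<And>n. \<bar>L (monom 1 n)\<bar> \<le> C * (R + e) ^ n"
    using growth_all[OF assms] by blast
  have "\<bar>L (monom 1 n * s)\<bar> \<le> (\<Sum>i\<le>degree s. \<bar>coeff s i\<bar> * (C * (R + e) ^ i)) * (R + e) ^ n" for n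
  proof -
    have "monom 1 n * s = (\<Sum>i\<le>degree s. smult (coeff s i) (monom 1 (n + i)))"
      by (subst (1) poly_as_sum_of_monoms[of s, symmetric])
         (simp add: sum_distrib_left mult_monom smult_monom)
    then have "\<bar>L (monom 1 n * s)\<bar> = \<bar>\<Sum>i\<le>degree s. coeff s i * L (monom 1 (n + i))\<bar>"
      by (simp add: sum smult)
    also have "\<dots> \<le> (\<Sum>i\<le>degree s. \<bar>coeff s i\<bar> * \<bar>L (monom 1 (n + i))\<bar>)"
      by (rule order.trans[OF sum_abs]) (simp add: abs_mult)
    also have "\<dots> \<le> (\<Sum>i\<le>degree s. \<bar>coeff s i\<bar> * (C * (R + e) ^ (n + i)))"
      by (intro sum_mono mult_left_mono C) auto
    also have "\<dots> = (\<Sum>i\<le>degree s. \<bar>coeff s i\<bar> * (C * (R + e) ^ i)) * (R + e) ^ n"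
      unfolding sum_distrib_right by (intro sum.cong refl) (simp add: power_add)
    finally show ?thesis .
  qed
  then show ?thesis by blast
qed

text \<open>The numerical radius of multiplication by \<open>x\<close> is at most its spectral radius. With
  \<open>a\<^sub>n = L(x\<^sup>n p\<^sup>2)\<close> and \<open>t = \<bar>a\<^sub>1\<bar> / a\<^sub>0\<close>, repeated use of Cauchy-Schwarz gives
  \<open>t\<^bsup>m\<^esup> \<le> a\<^sub>m / a\<^sub>0\<close> for all \<open>m = 2\<^bsup>k\<^esup>\<close> with \<open>k \<ge> 1\<close>, which contradicts the growth of \<open>a\<close> if \<open>t > R\<close>.\<close>

lemma abs_mult_X_le: "\<bar>L (monom 1 1 * (p * p))\<bar> \<le> R * L (p * p)"
proof -
  define a where "a n = L (monom 1 n * (p * p))" for n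
  have a0: "a 0 = L (p * p)" by (simp add: a_def)
  have CS: "(a n)\<^sup>2 \<le> a 0 * a (2 * n)" for n
  proof -
    have "p * (monom 1 n * p) = monom 1 n * (p * p)" by (simp only: mult_ac)
    moreover have "monom 1 n * p * (monom 1 n * p) = monom 1 n * monom 1 n * (p * p)"
      by (simp only: mult_ac)
    ultimately show ?thesis
      using Cauchy_Schwarz[of p "monom 1 n * p"] unfolding a0 by (simp only: a_def mult_monom mult_2 mult_1)
  qed
  show ?thesis
  proof (cases "a 0 = 0")
    case True
    then show ?thesis using CS[of 1] a0 by (simp add: a_def)
  next
    case False
    then have pos: "a 0 > 0" using square[of p] a0 by simp
    define t where "t = \<bar>a 1\<bar> / a 0"
    have iter: "t ^ (2 ^ k) \<le> a (2 ^ k) / a 0" if "k \<ge> 1" for k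
      using that
    proof (induction k rule: dec_induct)
      case base
      then show ?case using CS[of 1] pos by (simp add: t_def power_divide power2_eq_square field_simps)
    next
      case (step k)
      have "t ^ (2 ^ Suc k) = (t ^ (2 ^ k))\<^sup>2" by (simp add: power_mult[symmetric] mult.commute)
      also have "\<dots> \<le> (a (2 ^ k) / a 0)\<^sup>2"
        using step.IH pos by (intro power_mono) (auto simp: t_def)
      also have "\<dots> = (a (2 ^ k))\<^sup>2 / (a 0 * a 0)" by (simp add: power_divide power2_eq_square)
      also have "\<dots> \<le> a 0 * a (2 * 2 ^ k) / (a 0 * a 0)"
        using pos by (intro divide_right_mono CS) auto
      also have "\<dots> = a (2 ^ Suc k) / a 0" using pos by simp
      finally show ?case .
    qed
    have "t \<le> R"
    proof (rule ccontr)
      assume "\<not> t \<le> R"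
      define e where "e = (t - R) / 2"
      have e: "e > 0" "R + e < t"
        using \<open>\<not> t \<le> R\<close> by (auto simp: e_def field_simps)
      obtain C where C: "\<And>n. \<bar>a n\<bar> \<le> C * (R + e) ^ n"
        using growth_poly[OF e(1), of "p * p"] unfolding a_def by blast
      define x where "x = t / (R + e)"
      have x: "x > 1" using e R_pos by (simp add: x_def)
      obtain k where k: "C / a 0 < x ^ k" using real_arch_pow[OF x] by blast
      have "x ^ k \<le> x ^ (2 ^ Suc k)"
        using x by (intro power_increasing) (auto intro: order.trans[OF less_imp_le[OF less_exp]])
      also have "\<dots> = t ^ (2 ^ Suc k) / (R + e) ^ (2 ^ Suc k)" by (simp add: x_def power_divide)
      also have "\<dots> \<le> (a (2 ^ Suc k) / a 0) / (R + e) ^ (2 ^ Suc k)"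
        using e R_pos by (intro divide_right_mono iter) auto
      also have "\<dots> \<le> (C * (R + e) ^ (2 ^ Suc k) / a 0) / (R + e) ^ (2 ^ Suc k)"
        using e R_pos pos C[of "2 ^ Suc k"] by (intro divide_right_mono) auto
      also have "\<dots> = C / a 0" using e R_pos by simp
      finally show False using k by simp
    qed
    then have "\<bar>a 1\<bar> \<le> R * a 0" using pos by (simp add: t_def field_simps)
    then show ?thesis unfolding a0 by (simp only: a_def)
  qed
qed

text \<open>The affine coordinate that maps \<open>[-R, R]\<close> to \<open>[0, 1]\<close>.\<close>

definition X :: "real poly" where "X = [:1 / 2, 1 / (2 * R):]"

lemma X_mult: "L (X * s) = (R * L s + L (monom 1 1 * s)) / (2 * R)"
proof -
  have "X * s = smult (1 / 2) s + smult (1 / (2 * R)) (monom 1 1 * s)"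
    by (simp add: X_def monom_Suc)
  then show ?thesis using R_pos by (simp add: add smult field_simps)
qed

lemma X_square_nonneg: "L (X * (p * p)) \<ge> 0"
  using abs_mult_X_le[of p] R_pos by (simp add: X_mult)

lemma one_minus_X_square_nonneg: "L ((1 - X) * (p * p)) \<ge> 0"
proof -
  have "L ((1 - X) * (p * p)) = L (p * p) - L (X * (p * p))"
    by (simp only: left_diff_distrib diff mult_1_left)
  also have "\<dots> = (R * L (p * p) - L (monom 1 1 * (p * p))) / (2 * R)"
    using R_pos by (simp only: X_mult) (simp add: field_simps)
  also have "\<dots> \<ge> 0" using abs_mult_X_le[of p] R_pos by simp
  finally show ?thesis .
qed

text \<open>Squares can be split off until both exponents are \<open>0\<close> or \<open>1\<close>. The remaining mixed case follows
  from \<open>X (1 - X) = X\<^sup>2 (1 - X) + X (1 - X)\<^sup>2\<close>.\<close>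

lemma Bernstein_nonneg: "L (X ^ i * (1 - X) ^ j) \<ge> 0"
proof -
  define p where "p = X ^ (i div 2) * (1 - X) ^ (j div 2)"
  have halves: "Y ^ n = (if odd n then Y else 1) * (Y ^ (n div 2) * Y ^ (n div 2))"
    for Y :: "real poly" and n
    by (cases "even n") (auto elim!: evenE oddE simp: power_add[symmetric] mult_2)
  have eq: "X ^ i * (1 - X) ^ j =
      (if odd i then X else 1) * (if odd j then 1 - X else 1) * (p * p)"
    by (subst halves[of X i], subst halves[of "1 - X" j]) (simp only: p_def mult_ac)
  consider "even i" "even j" | "odd i" "even j" | "even i" "odd j" | "odd i" "odd j" by blast
  then show ?thesis
  proof cases
    case 4
    have "X * (1 - X) * (p * p) = (1 - X) * ((X * p) * (X * p)) + X * (((1 - X) * p) * ((1 - X) * p))"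
      by (simp add: algebra_simps)
    then show ?thesis
      using X_square_nonneg[of "(1 - X) * p"] one_minus_X_square_nonneg[of "X * p"] 4
      by (simp add: eq add)
  next
    case 1
    then show ?thesis using square[of p] by (simp add: eq)
  next
    case 2
    then show ?thesis using X_square_nonneg[of p] by (simp add: eq)
  next
    case 3
    then show ?thesis using one_minus_X_square_nonneg[of p] by (simp add: eq)
  qed
qed

text \<open>The value of the functional \<open>p \<mapsto> L(X\<^sup>l p)\<close> at the \<open>j\<close>-th Bernstein polynomial of
  degree \<open>k\<close>. The case \<open>l = 0\<close> is the one of interest; the others serve the induction in
  \<open>weight_moments\<close>.\<close>

definition weight :: "nat \<Rightarrow> nat \<Rightarrow> nat \<Rightarrow> real" where
  "weight l k j = real (k choose j) * L (X ^ l * (X ^ j * (1 - X) ^ (k - j)))"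

lemma weight_nonneg: "weight l k j \<ge> 0"
  unfolding weight_def mult.assoc[symmetric] power_add[symmetric]
  by (intro mult_nonneg_nonneg Bernstein_nonneg) auto

lemma sum_weight: "(\<Sum>j\<le>k. weight l k j) = L (X ^ l)"
proof -
  have "X ^ l = X ^ l * (X + (1 - X)) ^ k" by simp
  also have "\<dots> = (\<Sum>j\<le>k. smult (real (k choose j)) (X ^ l * (X ^ j * (1 - X) ^ (k - j))))"
    unfolding binomial_ring sum_distrib_left
    by (intro sum.cong refl) (simp add: of_nat_poly mult_ac)
  finally have "L (X ^ l) = L \<dots>" by (rule arg_cong)
  then show ?thesis by (simp add: weight_def sum smult)
qed

text \<open>The identity \<open>X B\<^sub>k\<^sub>j = (j + 1)/(k + 1) B\<^bsub>k+1,j+1\<^esub>\<close> for the Bernstein polynomials \<open>B\<^sub>k\<^sub>j\<close>.\<close>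

lemma weight_Suc: "weight l (Suc k) (Suc j) * (Suc j / Suc k) = weight (Suc l) k j"
proof -
  have "real (Suc k choose Suc j) * (Suc j / Suc k) = real (k choose j)"
    using Suc_times_binomial[of j k] by (simp add: field_simps flip: of_nat_mult del: of_nat_Suc)
  moreover have "X ^ l * (X ^ Suc j * (1 - X) ^ (Suc k - Suc j)) =
      X ^ Suc l * (X ^ j * (1 - X) ^ (k - j))" by (simp add: mult_ac)
  ultimately show ?thesis by (simp only: weight_def mult.assoc mult.commute[of "L _"]) (simp only: mult.assoc[symmetric])
qed

lemma power_diff_le:
  fixes x y :: real
  assumes "0 \<le> x" "x \<le> y" "y \<le> 1"
  shows "y ^ i - x ^ i \<le> i * (y - x)"
proof (induction i)
  case (Suc i)
  have "y ^ Suc i - x ^ Suc i = y * (y ^ i - x ^ i) + x ^ i * (y - x)" by (simp add: algebra_simps)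
  also have "\<dots> \<le> 1 * (y ^ i - x ^ i) + 1 * (y - x)"
    using assms by (intro add_mono mult_right_mono) (auto intro: power_mono power_le_one)
  finally show ?case using Suc by (simp add: algebra_simps)
qed simp

text \<open>Induction on \<open>i\<close>: by the previous identity one factor \<open>j/k\<close> can be traded for one factor \<open>X\<close> inside
  \<open>L\<close>, at the price of moving the nodes from \<open>j/k\<close> to \<open>(j + 1)/(k + 1)\<close>. This shift is at most \<open>1/(k + 1)\<close>,
  and the total mass \<open>L(X\<^sup>l\<^sup>+\<^sup>1)\<close> stays fixed.\<close>

lemma weight_moments: "(\<lambda>k. \<Sum>j\<le>k. weight l k j * (j / k) ^ i) \<longlonglongrightarrow> L (X ^ (l + i))"
proof (induction i arbitrary: l)
  case 0
  then show ?case by (simp add: sum_weight)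
next
  case (Suc i)
  have "(\<lambda>k. \<Sum>j\<le>Suc k. weight l (Suc k) j * (j / Suc k) ^ Suc i) \<longlonglongrightarrow> L (X ^ (Suc l + i))"
  proof (rule Lim_transform)
    show "(\<lambda>k. \<Sum>j\<le>k. weight (Suc l) k j * (j / k) ^ i) \<longlonglongrightarrow> L (X ^ (Suc l + i))"
      by (rule Suc.IH)
    have eq: "(\<Sum>j\<le>Suc k. weight l (Suc k) j * (j / Suc k) ^ Suc i) =
        (\<Sum>j\<le>k. weight (Suc l) k j * (Suc j / Suc k) ^ i)" for k
    proof -
      have "(\<Sum>j\<le>Suc k. weight l (Suc k) j * (j / Suc k) ^ Suc i) =
          (\<Sum>j\<le>k. weight l (Suc k) (Suc j) * (Suc j / Suc k) ^ Suc i)"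
        unfolding lessThan_Suc_atMost[symmetric] sum.lessThan_Suc_shift by simp
      also have "\<dots> = (\<Sum>j\<le>k. weight (Suc l) k j * (Suc j / Suc k) ^ i)"
        by (intro sum.cong refl) (simp add: weight_Suc[symmetric] mult_ac)
      finally show ?thesis .
    qed
    have bnd: "norm ((\<Sum>j\<le>Suc k. weight l (Suc k) j * (j / Suc k) ^ Suc i) -
        (\<Sum>j\<le>k. weight (Suc l) k j * (j / k) ^ i)) \<le> L (X ^ Suc l) * (i / Suc k)" if "k > 0" for k
    proof -
      have "norm ((\<Sum>j\<le>k. weight (Suc l) k j * (Suc j / Suc k) ^ i) -
          (\<Sum>j\<le>k. weight (Suc l) k j * (j / k) ^ i)) \<le>
          (\<Sum>j\<le>k. weight (Suc l) k j * (i / Suc k))"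
        unfolding sum_subtractf[symmetric] right_diff_distrib[symmetric]
      proof (rule sum_norm_le)
        fix j assume "j \<in> {..k}"
        then have j: "real j \<le> real k" by simp
        have step: "real j / k \<le> real (Suc j) / Suc k" "real (Suc j) / Suc k \<le> 1"
          using j that by (simp_all add: field_simps)
        have "real (Suc j) / Suc k - real j / k = (1 - real j / k) / Suc k"
          using that by (simp add: field_simps)
        also have "\<dots> \<le> 1 / Suc k" by (intro divide_right_mono) auto
        finally have gap: "real (Suc j) / Suc k - real j / k \<le> 1 / Suc k" .
        have "(Suc j / Suc k) ^ i - (j / k) ^ i \<le> i * (Suc j / Suc k - j / k)"
          by (rule power_diff_le) (use step in auto)
        also have "\<dots> \<le> i * (1 / Suc k)" by (rule mult_left_mono[OF gap]) simp
        finally have "(Suc j / Suc k) ^ i - (j / k) ^ i \<le> i / Suc k" by simp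
        moreover have "(real j / k) ^ i \<le> (Suc j / Suc k) ^ i"
          by (rule power_mono[OF step(1)]) simp
        ultimately have "\<bar>(Suc j / Suc k) ^ i - (j / k) ^ i\<bar> \<le> i / Suc k" by simp
        then show "norm (weight (Suc l) k j * ((Suc j / Suc k) ^ i - (j / k) ^ i)) \<le>
            weight (Suc l) k j * (i / Suc k)"
          unfolding real_norm_def abs_mult abs_of_nonneg[OF weight_nonneg]
          by (rule mult_left_mono[OF _ weight_nonneg])
      qed
      then show ?thesis unfolding eq sum_distrib_right[symmetric] sum_weight .
    qed
    have "eventually (\<lambda>k. norm ((\<Sum>j\<le>Suc k. weight l (Suc k) j * (j / Suc k) ^ Suc i) -
        (\<Sum>j\<le>k. weight (Suc l) k j * (j / k) ^ i)) \<le> L (X ^ Suc l) * (i / Suc k)) sequentially"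
      by (rule eventually_mono[OF eventually_gt_at_top[of 0]]) (rule bnd)
    moreover have "(\<lambda>k. L (X ^ Suc l) * (i / Suc k)) \<longlonglongrightarrow> 0" by real_asymp
    ultimately show "(\<lambda>k. (\<Sum>j\<le>Suc k. weight l (Suc k) j * (j / Suc k) ^ Suc i) -
        (\<Sum>j\<le>k. weight (Suc l) k j * (j / k) ^ i)) \<longlonglongrightarrow> 0"
      by (rule Lim_null_comparison)
  qed
  then have "(\<lambda>k. \<Sum>j\<le>k. weight l k j * (j / k) ^ Suc i) \<longlonglongrightarrow> L (X ^ (Suc l + i))"
    by (rule LIMSEQ_imp_Suc)
  then show ?case by (simp only: add_Suc add_Suc_right)
qed

definition node :: "nat \<Rightarrow> nat \<Rightarrow> real" where
  "node k j = R * (2 * (j / k) - 1)"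

lemma abs_node_le: "j \<le> k \<Longrightarrow> \<bar>node k j\<bar> \<le> R"
proof -
  assume "j \<le> k"
  then have "real j / k \<ge> 0" "real j / k \<le> 1" by (auto simp: divide_le_eq_1)
  then have "\<bar>2 * (real j / k) - 1\<bar> \<le> 1" by (simp add: abs_le_iff)
  then show ?thesis using R_pos by (simp add: node_def abs_mult)
qed

text \<open>The measures with masses \<open>weight 0 k j\<close> at the points \<open>node k j\<close> play the role of a spectral measure.\<close>

lemma discrete_approximation:
  "(\<lambda>k. \<Sum>j\<le>k. weight 0 k j * poly p (node k j)) \<longlonglongrightarrow> L p"
proof -
  define p' where "p' = p \<circ>\<^sub>p [:- R, 2 * R:]"
  have "[:- R, 2 * R:] \<circ>\<^sub>p X = [:0, 1:]"
    using R_pos by (simp add: X_def pcompose_pCons)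
  then have "p' \<circ>\<^sub>p X = p" by (simp add: p'_def pcompose_assoc[symmetric])
  moreover have "p' \<circ>\<^sub>p X = (\<Sum>i\<le>degree p'. smult (coeff p' i) (X ^ i))"
    unfolding poly_eq_poly_eq_iff[symmetric]
    by (rule ext) (simp add: poly_pcompose poly_sum poly_altdef[of p'])
  ultimately have p: "p = (\<Sum>i\<le>degree p'. smult (coeff p' i) (X ^ i))" by simp
  have node: "poly p (node k j) = (\<Sum>i\<le>degree p'. coeff p' i * (j / k) ^ i)" for k j
  proof -
    have "poly p (node k j) = poly p' (j / k)"
      by (simp add: p'_def poly_pcompose node_def algebra_simps)
    then show ?thesis by (simp add: poly_altdef)
  qed
  have "(\<lambda>k. \<Sum>i\<le>degree p'. coeff p' i * (\<Sum>j\<le>k. weight 0 k j * (j / k) ^ i)) \<longlonglongrightarrow>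
      (\<Sum>i\<le>degree p'. coeff p' i * L (X ^ (0 + i)))"
    by (intro tendsto_intros weight_moments)
  also have "(\<Sum>i\<le>degree p'. coeff p' i * L (X ^ (0 + i))) = L p"
    by (subst p) (simp add: sum smult)
  also have "(\<lambda>k. \<Sum>i\<le>degree p'. coeff p' i * (\<Sum>j\<le>k. weight 0 k j * (j / k) ^ i)) =
      (\<lambda>k. \<Sum>j\<le>k. weight 0 k j * poly p (node k j))"
    by (rule ext) (subst sum_distrib_left, subst sum.swap, simp add: node sum_distrib_left mult_ac)
  finally show ?thesis .
qed

end

section \<open>The generating function of the sphere polynomials\<close>

text \<open>Up to the factor \<open>1 - z\<^sup>2\<close> this is the resolvent \<open>1 / (s - \<mu>)\<close> at the point \<open>s = 1/z + q z\<close>, divided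
  by \<open>z\<close>; clearing denominators removes the singularity at \<open>z = 0\<close>.\<close>

definition resolvent :: "real \<Rightarrow> real \<Rightarrow> complex \<Rightarrow> complex" where
  "resolvent q \<mu> z = (1 - z\<^sup>2) / (1 + of_real q * z\<^sup>2 - of_real \<mu> * z)"

lemma abs_sphere_poly_le:
  assumes "\<bar>\<mu>\<bar> \<le> R" "q \<ge> 1"
  shows "\<bar>poly (sphere_poly q n) \<mu>\<bar> \<le> (R + q + 1) ^ n"
  using assms
proof (induction q n rule: sphere_poly.induct)
  case (3 q n)
  define B where "B = R + q + 1"
  define c where "c = (if n = 0 then q + 1 else q)"
  have R: "0 \<le> R" using 3 by linarith
  then have B: "B \<ge> 1" and c: "0 \<le> c" "c \<le> q + 1" using 3 by (auto simp: B_def c_def)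
  have "poly (sphere_poly q (Suc (Suc n))) \<mu> =
      \<mu> * poly (sphere_poly q (Suc n)) \<mu> - c * poly (sphere_poly q n) \<mu>"
    by (simp add: poly_monom c_def)
  then have "\<bar>poly (sphere_poly q (Suc (Suc n))) \<mu>\<bar> \<le>
      \<bar>\<mu>\<bar> * \<bar>poly (sphere_poly q (Suc n)) \<mu>\<bar> + \<bar>c\<bar> * \<bar>poly (sphere_poly q n) \<mu>\<bar>"
    by (simp add: abs_mult[symmetric] del: sphere_poly.simps)
  also have "\<dots> \<le> R * B ^ Suc n + (q + 1) * B ^ Suc n"
  proof (intro add_mono mult_mono)
    have "B ^ n \<le> B ^ Suc n" using B by (intro power_increasing) auto
    moreover have "\<bar>poly (sphere_poly q n) \<mu>\<bar> \<le> B ^ n" using 3 by (simp only: B_def)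
    ultimately show "\<bar>poly (sphere_poly q n) \<mu>\<bar> \<le> B ^ Suc n" by (rule order.trans[rotated])
    show "\<bar>poly (sphere_poly q (Suc n)) \<mu>\<bar> \<le> B ^ Suc n" using 3 by (simp only: B_def)
    show "\<bar>\<mu>\<bar> \<le> R" "\<bar>c\<bar> \<le> q + 1" "0 \<le> R" "0 \<le> q + 1" using 3(3,4) R c by simp_all
  qed simp_all
  also have "\<dots> = B ^ Suc (Suc n)" by (simp add: B_def algebra_simps)
  finally show ?case by (simp add: B_def)
qed (auto simp: poly_monom)

text \<open>The recursion of the polynomials, summed against \<open>z\<^sup>n\<close>, is a linear equation for the generating
  function. The bound on \<open>z\<close> is crude but suffices, since the identity is needed only near \<open>0\<close>.\<close>

lemma resolvent_sums:
  fixes z :: complex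
  assumes "\<bar>\<mu>\<bar> \<le> R" "q \<ge> 1" "norm z * (R + q + 1) < 1"
  shows "(\<lambda>n. of_real (poly (sphere_poly q n) \<mu>) * z ^ n) sums resolvent q \<mu> z"
proof -
  define B where "B = R + q + 1"
  define p where "p n = of_real (poly (sphere_poly q n) \<mu>) * z ^ n" for n
  have R: "0 \<le> R" using assms by linarith
  then have B: "B \<ge> 1" using assms by (simp add: B_def)
  have z1: "norm z \<le> 1"
  proof -
    have "norm z * 1 \<le> norm z * B" using B by (intro mult_left_mono) auto
    then show ?thesis using assms by (simp add: B_def)
  qed
  have "norm (p n) \<le> (norm z * B) ^ n" for n
    using abs_sphere_poly_le[OF assms(1,2), of n]
    by (simp add: p_def norm_mult norm_power power_mult_distrib B_def mult.commute mult_left_mono)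
  moreover have "summable (\<lambda>n. (norm z * B) ^ n)"
    using assms B by (intro summable_geometric) (auto simp: B_def)
  ultimately have summ: "summable p" by (rule summable_comparison_test'[rotated])
  define s where "s = suminf p"
  have s: "p sums s" using summ by (simp add: s_def summable_sums)
  have p0: "p 0 = 1" and p1: "p 1 = of_real \<mu> * z" by (simp_all add: p_def poly_monom)
  have s1: "(\<lambda>n. p (Suc n)) sums (s - 1)" using s p0 by (simp add: sums_Suc_iff)
  then have s2: "(\<lambda>n. p (Suc (Suc n))) sums (s - 1 - of_real \<mu> * z)"
    using p1 by (subst sums_Suc_iff) simp
  have rec: "p (Suc (Suc n)) = of_real \<mu> * z * p (Suc n) - of_real q * z\<^sup>2 * p n -
      (if n = 0 then z\<^sup>2 else 0)" for n
    by (simp add: p_def poly_monom power2_eq_square algebra_simps)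
  have "(\<lambda>n. of_real \<mu> * z * p (Suc n) - of_real q * z\<^sup>2 * p n - (if n = 0 then z\<^sup>2 else 0)) sums
      (of_real \<mu> * z * (s - 1) - of_real q * z\<^sup>2 * s - z\<^sup>2)"
    by (intro sums_diff sums_mult s s1) (use sums_single[of 0 "\<lambda>_. z\<^sup>2"] in simp)
  then have "of_real \<mu> * z * (s - 1) - of_real q * z\<^sup>2 * s - z\<^sup>2 = s - 1 - of_real \<mu> * z"
    using s2 unfolding rec by (rule sums_unique2)
  then have eq: "s * (1 + of_real q * z\<^sup>2 - of_real \<mu> * z) = 1 - z\<^sup>2"
    by (simp add: algebra_simps)
  have "norm (of_real q * z\<^sup>2 - of_real \<mu> * z) \<le> q * (norm z)\<^sup>2 + \<bar>\<mu>\<bar> * norm z"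
    using assms by (intro order.trans[OF norm_triangle_ineq4]) (simp add: norm_mult norm_power)
  also have "\<dots> \<le> q * norm z + R * norm z"
    using assms z1 by (intro add_mono mult_left_mono mult_right_mono) (auto simp: power2_eq_square mult_left_le)
  also have "\<dots> \<le> norm z * (R + q + 1)" by (simp add: algebra_simps)
  also have "\<dots> < 1" by fact
  finally have "1 + of_real q * z\<^sup>2 - of_real \<mu> * z \<noteq> 0"
    by (metis add.commute add_diff_eq add_eq_0_iff norm_minus_cancel norm_one order_less_irrefl)
  then have "s = resolvent q \<mu> z" using eq by (simp add: resolvent_def field_simps)
  then show ?thesis using s by (simp add: p_def[abs_def])
qed

text \<open>Both sides equal \<open>1 / (1/z + q z - \<mu>)\<close>, in which \<open>1/z\<close> and \<open>q z\<close> exchange their roles.\<close>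

lemma resolvent_symmetric:
  assumes "z \<noteq> 0" "q \<noteq> 0" "w = 1 / (of_real q * z)" "z\<^sup>2 \<noteq> 1" "w\<^sup>2 \<noteq> 1"
  shows "z * resolvent q \<mu> z / (1 - z\<^sup>2) = w * resolvent q \<mu> w / (1 - w\<^sup>2)"
proof -
  have w0: "w \<noteq> 0" using assms by auto
  have *: "z * resolvent q \<mu> z / (1 - z\<^sup>2) = 1 / (1 / z + of_real q * z - of_real \<mu>)"
    if "z \<noteq> 0" "z\<^sup>2 \<noteq> 1" for z :: complex
  proof -
    have "1 + of_real q * z\<^sup>2 - of_real \<mu> * z = z * (1 / z + of_real q * z - of_real \<mu>)"
      using that by (simp add: field_simps power2_eq_square)
    then show ?thesis using that by (simp add: resolvent_def)
  qed
  have "1 / w = of_real q * z" "of_real q * w = 1 / z" using assms by simp_all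
  then have "1 / w + of_real q * w = 1 / z + of_real q * z" by simp
  then show ?thesis using *[of z] *[of w] assms w0 by simp
qed

definition resolvent_sum :: "real \<Rightarrow> 'i set \<Rightarrow> ('i \<Rightarrow> real) \<Rightarrow> ('i \<Rightarrow> real) \<Rightarrow> complex \<Rightarrow> complex" where
  "resolvent_sum q J w \<nu> z = (\<Sum>j\<in>J. of_real (w j) * resolvent q (\<nu> j) z)"

text \<open>On a compact set of points \<open>z\<close> the resolvents with parameter in \<open>S\<close> are uniformly bounded by
  compactness, hence so are their averages, and Montel's theorem applies.\<close>

lemma resolvent_sum_subsequence:
  fixes S :: "real set" and \<Omega> :: "complex set"
    and J :: "nat \<Rightarrow> 'i set" and w \<nu> :: "nat \<Rightarrow> 'i \<Rightarrow> real"
  assumes "compact S" "open \<Omega>"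
    and nz: "\<And>z \<mu>. z \<in> \<Omega> \<Longrightarrow> \<mu> \<in> S \<Longrightarrow> 1 + of_real q * z\<^sup>2 - of_real \<mu> * z \<noteq> 0"
    and w: "\<And>k j. j \<in> J k \<Longrightarrow> w k j \<ge> 0" "\<And>k. (\<Sum>j\<in>J k. w k j) \<le> 1"
    and \<nu>: "\<And>k j. j \<in> J k \<Longrightarrow> \<nu> k j \<in> S"
  obtains g \<rho> where "g holomorphic_on \<Omega>" "strict_mono (\<rho> :: nat \<Rightarrow> nat)"
    "\<And>z. z \<in> \<Omega> \<Longrightarrow> (\<lambda>n. resolvent_sum q (J (\<rho> n)) (w (\<rho> n)) (\<nu> (\<rho> n)) z) \<longlonglongrightarrow> g z"
proof -
  define F where "F k = resolvent_sum q (J k) (w k) (\<nu> k)" for k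
  have hol: "F k holomorphic_on \<Omega>" for k
    unfolding F_def resolvent_sum_def resolvent_def
    by (intro holomorphic_intros) (use nz \<nu> in auto)
  have bounded: "\<exists>B. \<forall>h\<in>range F. \<forall>z\<in>K. norm (h z) \<le> B" if K: "compact K" "K \<subseteq> \<Omega>" for K
  proof -
    have "continuous_on (K \<times> S) (\<lambda>(z, \<mu>). resolvent q \<mu> z)"
      unfolding resolvent_def case_prod_unfold
      by (intro continuous_intros) (use nz K in auto)
    then have "compact ((\<lambda>(z, \<mu>). resolvent q \<mu> z) ` (K \<times> S))"
      using K \<open>compact S\<close> by (intro compact_continuous_image compact_Times)
    then obtain B where "B > 0" "\<forall>y\<in>(\<lambda>(z, \<mu>). resolvent q \<mu> z) ` (K \<times> S). norm y \<le> B"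
      using compact_imp_bounded bounded_pos by metis
    then have B: "norm (resolvent q \<mu> z) \<le> B" if "z \<in> K" "\<mu> \<in> S" for z \<mu>
      using that by auto
    have "norm (F k z) \<le> B" if "z \<in> K" for k z
    proof -
      have "norm (F k z) \<le> (\<Sum>j\<in>J k. w k j * B)"
        unfolding F_def resolvent_sum_def
        by (rule sum_norm_le) (use w(1) B[OF that] \<nu> in \<open>auto simp: norm_mult intro!: mult_left_mono\<close>)
      also have "\<dots> = (\<Sum>j\<in>J k. w k j) * B" by (simp add: sum_distrib_right)
      also have "\<dots> \<le> 1 * B" using w(2) \<open>B > 0\<close> by (intro mult_right_mono) auto
      finally show ?thesis by simp
    qed
    then show ?thesis by blast
  qed
  note result = that
  show thesis
  proof (rule Montel[of \<Omega> "range F" F])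
    show "h holomorphic_on \<Omega>" if "h \<in> range F" for h
      using that hol by blast
    show "\<exists>B. \<forall>h\<in>range F. \<forall>z\<in>K. norm (h z) \<le> B" if "compact K" "K \<subseteq> \<Omega>" for K
      using that by (rule bounded)
    show "thesis" if "g holomorphic_on \<Omega>" "strict_mono \<rho>"
      "\<And>z. z \<in> \<Omega> \<Longrightarrow> (\<lambda>n. F (\<rho> n) z) \<longlonglongrightarrow> g z" for g \<rho>
      by (rule result[OF that(1,2)]) (use that(3) in \<open>simp add: F_def\<close>)
  qed (use \<open>open \<Omega>\<close> in auto)
qed

text \<open>Tannery's theorem passes to the limit in the Taylor coefficients: the coefficient of \<open>z\<^sup>n\<close>
  in the \<open>k\<close>-th sum is the integral of \<open>P\<^sub>n\<close> against the \<open>k\<close>-th measure, and it is bounded by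
  \<open>(R + q + 1)\<^sup>n\<close> for all \<open>k\<close>.\<close>

lemma sums_of_discrete_approximation:
  fixes w \<nu> :: "nat \<Rightarrow> nat \<Rightarrow> real" and c :: "nat \<Rightarrow> real" and z :: complex
  assumes q: "q \<ge> 1" and z: "norm z * (R + q + 1) < 1"
    and w: "\<And>k j. w k j \<ge> 0" "\<And>k. (\<Sum>j\<le>k. w k j) = 1"
    and \<nu>: "\<And>k j. j \<le> k \<Longrightarrow> \<bar>\<nu> k j\<bar> \<le> R"
    and lim: "\<And>n. (\<lambda>k. \<Sum>j\<le>k. w k j * poly (sphere_poly q n) (\<nu> k j)) \<longlonglongrightarrow> c n"
    and F: "(\<lambda>n. resolvent_sum q {..\<rho> n} (w (\<rho> n)) (\<nu> (\<rho> n)) z) \<longlonglongrightarrow> F"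
    and \<rho>: "strict_mono (\<rho> :: nat \<Rightarrow> nat)"
  shows "(\<lambda>n. of_real (c n) * z ^ n) sums F"
proof -
  define B where "B = R + q + 1"
  define a where "a n k = of_real (\<Sum>j\<le>k. w k j * poly (sphere_poly q n) (\<nu> k j)) * z ^ n" for n k
  have R: "0 \<le> R" using \<nu>[of 0 0] by simp
  have B: "B \<ge> 1" using R q by (simp add: B_def)
  have a_sums: "(\<lambda>n. a n k) sums resolvent_sum q {..k} (w k) (\<nu> k) z" for k
  proof -
    have "(\<lambda>n. \<Sum>j\<le>k. of_real (w k j) * (of_real (poly (sphere_poly q n) (\<nu> k j)) * z ^ n)) sums
        resolvent_sum q {..k} (w k) (\<nu> k) z"
      unfolding resolvent_sum_def
      by (intro sums_sum sums_mult resolvent_sums[OF _ q z] \<nu>) auto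
    then show ?thesis by (simp add: a_def sum_distrib_right mult.assoc)
  qed
  have bound: "norm (a n k) \<le> (B * norm z) ^ n" for n k
  proof -
    have "\<bar>\<Sum>j\<le>k. w k j * poly (sphere_poly q n) (\<nu> k j)\<bar> \<le> (\<Sum>j\<le>k. w k j * B ^ n)"
    proof (rule order.trans[OF sum_abs], rule sum_mono)
      fix j assume "j \<in> {..k}"
      then show "\<bar>w k j * poly (sphere_poly q n) (\<nu> k j)\<bar> \<le> w k j * B ^ n"
        unfolding abs_mult abs_of_nonneg[OF w(1)] B_def
        by (intro mult_left_mono abs_sphere_poly_le \<nu> q w(1)) auto
    qed
    also have "\<dots> = B ^ n" by (simp add: sum_distrib_right[symmetric] w(2))
    finally have "\<bar>\<Sum>j\<le>k. w k j * poly (sphere_poly q n) (\<nu> k j)\<bar> * norm z ^ n \<le> B ^ n * norm z ^ n"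
      by (rule mult_right_mono) simp
    then show ?thesis
      unfolding a_def norm_mult norm_power norm_of_real power_mult_distrib .
  qed
  have "summable (\<lambda>n. (B * norm z) ^ n)"
    using z B by (intro summable_geometric) (auto simp: B_def mult.commute)
  moreover have "(\<lambda>k. a n k) \<longlonglongrightarrow> of_real (c n) * z ^ n" for n
    unfolding a_def by (intro tendsto_intros lim)
  ultimately have T: "summable (\<lambda>n. norm (of_real (c n) * z ^ n))"
    "(\<lambda>k. suminf (\<lambda>n. a n k)) \<longlonglongrightarrow> (\<Sum>n. of_real (c n) * z ^ n)"
    using tannerys_theorem[of a "\<lambda>n. of_real (c n) * z ^ n" sequentially "\<lambda>n. (B * norm z) ^ n"] bound
    by (simp_all add: case_prod_unfold)
  have "(\<lambda>n. resolvent_sum q {..\<rho> n} (w (\<rho> n)) (\<nu> (\<rho> n)) z) \<longlonglongrightarrow> (\<Sum>n. of_real (c n) * z ^ n)"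
    using LIMSEQ_subseq_LIMSEQ[OF T(2) \<rho>] a_sums by (simp add: o_def sums_iff)
  then have "F = (\<Sum>n. of_real (c n) * z ^ n)" using F LIMSEQ_unique by blast
  moreover have "summable (\<lambda>n. of_real (c n) * z ^ n)" using T(1) by (rule summable_norm_cancel)
  ultimately show ?thesis by (simp add: summable_sums)
qed

text \<open>The identity of the function with its power series near \<open>0\<close> determines all Taylor coefficients, and the
  Taylor series converges on every disc of holomorphy.\<close>

lemma power_series_extension:
  fixes c :: "nat \<Rightarrow> complex"
  assumes hol: "f holomorphic_on ball 0 \<rho>" and z: "norm z < \<rho>"
    and e: "e > 0" "\<And>z. norm z < e \<Longrightarrow> (\<lambda>n. c n * z ^ n) sums f z"
  shows "(\<lambda>n. c n * z ^ n) sums f z"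
proof -
  have "f has_fps_expansion Abs_fps c"
    unfolding has_fps_expansion_def
  proof
    have "summable (\<lambda>n. c n * of_real (e / 2) ^ n)"
      using e(2)[of "of_real (e / 2)"] e(1) by (auto simp: sums_iff)
    then have "conv_radius c \<ge> norm (complex_of_real (e / 2))"
      by (rule conv_radius_geI)
    then have "fps_conv_radius (Abs_fps c) \<ge> ereal (e / 2)"
      using e(1) by (simp add: fps_conv_radius_def)
    then show "0 < fps_conv_radius (Abs_fps c)"
      using e(1) by (metis ereal_less(2) half_gt_zero less_le_trans)
    have "eventually (\<lambda>z. z \<in> ball 0 e) (nhds (0 :: complex))"
      using e(1) by (intro eventually_nhds_in_open) auto
    then show "eventually (\<lambda>z. eval_fps (Abs_fps c) z = f z) (nhds 0)"
      by eventually_elim (use e(2) in \<open>auto simp: eval_fps_def sums_iff\<close>)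
  qed
  then have "c n = (deriv ^^ n) f 0 / fact n" for n
    using fps_nth_fps_expansion[of f "Abs_fps c" n] by simp
  moreover have "(\<lambda>n. (deriv ^^ n) f 0 / fact n * (z - 0) ^ n) sums f z"
    by (rule holomorphic_power_series[OF hol]) (use z in simp)
  ultimately show ?thesis by (simp only: diff_zero)
qed

section \<open>Poles and the cut\<close>

text \<open>The two roots of the quadratic have product \<open>1/q\<close>, so they are either real or conjugate numbers of
  modulus \<open>q\<^bsup>-1/2\<^esup>\<close>, according to the sign of \<open>\<mu>\<^sup>2 - 4q\<close>.\<close>

lemma resolvent_denominator_root:
  fixes z :: complex
  assumes q: "q > 0" and root: "1 + of_real q * z\<^sup>2 - of_real \<mu> * z = 0"
  shows "z \<in> \<real> \<and> 1 + q * (Re z)\<^sup>2 = \<mu> * Re z \<or> \<mu>\<^sup>2 < 4 * q \<and> q * (norm z)\<^sup>2 = 1"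
proof (cases "Im z = 0")
  case True
  then show ?thesis
    using arg_cong[OF root, of Re] by (auto simp: complex_is_Real_iff power2_eq_square)
next
  case False
  have re: "1 + q * ((Re z)\<^sup>2 - (Im z)\<^sup>2) = \<mu> * Re z"
    using arg_cong[OF root, of Re] by (simp add: power2_eq_square algebra_simps)
  have "q * (2 * Re z * Im z) = \<mu> * Im z"
    using arg_cong[OF root, of Im] by (simp add: power2_eq_square algebra_simps)
  then have l: "\<mu> = 2 * q * Re z" using False by simp
  have n: "q * ((Re z)\<^sup>2 + (Im z)\<^sup>2) = 1"
    using re unfolding l by (simp add: power2_eq_square algebra_simps)
  have "\<mu>\<^sup>2 = 4 * q * (q * (Re z)\<^sup>2)" unfolding l by (simp add: power2_eq_square)
  also have "\<dots> < 4 * q * 1"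
  proof (intro mult_strict_left_mono)
    have "q * (Im z)\<^sup>2 > 0" using q False by simp
    then show "q * (Re z)\<^sup>2 < 1" using n by (simp add: distrib_left)
  qed (use q in auto)
  finally show ?thesis using n by (simp add: cmod_power2)
qed

lemma resolvent_denominator_nonzero_disc:
  fixes z :: complex
  assumes q: "q > 0" and z: "norm z < 1 / sqrt q" and \<mu>: "\<bar>\<mu>\<bar> \<le> 2 * sqrt q"
  shows "1 + of_real q * z\<^sup>2 - of_real \<mu> * z \<noteq> 0"
proof
  assume "1 + of_real q * z\<^sup>2 - of_real \<mu> * z = 0"
  then consider "z \<in> \<real>" "1 + q * (Re z)\<^sup>2 = \<mu> * Re z" | "q * (norm z)\<^sup>2 = 1"
    using resolvent_denominator_root[OF q] by blast
  moreover have s: "sqrt q * norm z < 1" using z q by (simp add: field_simps)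
  have sq: "(sqrt q)\<^sup>2 = q" using q by simp
  ultimately show False
  proof cases
    case 1
    have "norm z = \<bar>Re z\<bar>" using 1(1) by (metis Re_complex_of_real Reals_cases norm_of_real)
    then have "\<mu> * Re z \<le> 2 * sqrt q * norm z"
      using \<mu> by (metis abs_ge_self abs_mult abs_ge_zero mult_right_mono order_trans)
    moreover have "(Re z)\<^sup>2 = (norm z)\<^sup>2" using \<open>norm z = \<bar>Re z\<bar>\<close> by simp
    ultimately have "1 + (sqrt q * norm z)\<^sup>2 - 2 * (sqrt q * norm z) \<le> 0"
      using 1(2) sq by (simp add: power_mult_distrib)
    then have "(1 - sqrt q * norm z)\<^sup>2 \<le> 0" by (simp add: power2_diff)
    then show False using s by simp
  next
    case 2
    have "(sqrt q * norm z)\<^sup>2 < 1\<^sup>2" using s q by (intro power_strict_mono) auto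
    then show False using 2 sq by (simp add: power_mult_distrib)
  qed
qed

text \<open>The quadratic inequality says \<open>(\<gamma> x - 1) (q x - \<gamma>) \<le> 0\<close>. Under \<open>\<gamma>\<^sup>2 > q\<close> the root \<open>1/\<gamma>\<close> is the
  smaller one.\<close>

lemma between_reciprocals:
  fixes x :: real
  assumes "q > 0" "\<gamma> > 0" "\<gamma>\<^sup>2 > q" "1 + q * x\<^sup>2 \<le> (\<gamma> + q / \<gamma>) * x"
  shows "1 / \<gamma> \<le> x" "x \<le> \<gamma> / q"
proof -
  have "(\<gamma> * x - 1) * (q * x - \<gamma>) = \<gamma> * (1 + q * x\<^sup>2 - (\<gamma> + q / \<gamma>) * x)"
    using assms by (simp add: field_simps power2_eq_square)
  also have "\<dots> \<le> 0" using assms by (intro mult_nonneg_nonpos) auto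
  finally have prod: "(\<gamma> * x - 1) * (q * x - \<gamma>) \<le> 0" .
  have "\<not> \<gamma> * x < 1"
  proof
    assume less: "\<gamma> * x < 1"
    then have "q * (\<gamma> * x) < q * 1" using assms(1) by (rule mult_strict_left_mono)
    then have "q * x * \<gamma> < \<gamma> * \<gamma>"
      using assms(3) by (simp add: power2_eq_square mult_ac)
    then have "q * x < \<gamma>" using assms by simp
    then have "(\<gamma> * x - 1) * (q * x - \<gamma>) > 0" using less by (intro mult_neg_neg) auto
    then show False using prod by simp
  qed
  moreover have "\<not> q * x > \<gamma>"
  proof
    assume less: "q * x > \<gamma>"
    then have "\<gamma> * \<gamma> < \<gamma> * (q * x)" using assms(2) by (rule mult_strict_left_mono)
    then have "q * 1 < q * (\<gamma> * x)" using assms(3) by (simp add: power2_eq_square mult_ac)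
    then have "\<gamma> * x > 1" using assms(1) by (simp only: mult_less_cancel_left_pos)
    then have "(\<gamma> * x - 1) * (q * x - \<gamma>) > 0" using less by (intro mult_pos_pos) auto
    then show False using prod by simp
  qed
  ultimately have "1 \<le> \<gamma> * x" "q * x \<le> \<gamma>" by simp_all
  then show "1 / \<gamma> \<le> x" "x \<le> \<gamma> / q" using assms(1,2) by (simp_all add: field_simps)
qed

lemma cogrowth_cut_iff:
  assumes "\<gamma> > 0" "q > 0"
  shows "z \<in> cogrowth_cut q \<gamma> \<longleftrightarrow> z \<in> \<real> \<and> 1 / \<gamma> \<le> norm z \<and> norm z \<le> \<gamma> / q"
proof
  assume "z \<in> cogrowth_cut q \<gamma>"
  then obtain x where z: "z = of_real x" and x: "x \<in> {- \<gamma> / q .. - (1 / \<gamma>)} \<union> {1 / \<gamma> .. \<gamma> / q}"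
    using assms by (auto simp: cogrowth_cut_def)
  define a b where "a = 1 / \<gamma>" and "b = \<gamma> / q"
  have "a > 0" "x \<in> {- b..- a} \<union> {a..b}" using x assms by (auto simp: a_def b_def)
  then have "a \<le> \<bar>x\<bar> \<and> \<bar>x\<bar> \<le> b" by auto
  then show "z \<in> \<real> \<and> 1 / \<gamma> \<le> norm z \<and> norm z \<le> \<gamma> / q"
    by (simp add: z a_def b_def)
next
  assume z: "z \<in> \<real> \<and> 1 / \<gamma> \<le> norm z \<and> norm z \<le> \<gamma> / q"
  then obtain x where x: "z = of_real x" by (auto elim: Reals_cases)
  with z have "x \<in> {- \<gamma> / q .. - (1 / \<gamma>)} \<union> {1 / \<gamma> .. \<gamma> / q}" by (auto simp: abs_if split: if_splits)
  then show "z \<in> cogrowth_cut q \<gamma>" using assms x by (auto simp: cogrowth_cut_def)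
qed

text \<open>A real root \<open>z\<close> satisfies \<open>1/\<bar>z\<bar> + q \<bar>z\<bar> = \<bar>\<mu>\<bar> \<le> \<gamma> + q/\<gamma>\<close>, and by convexity of the left-hand side \<open>\<bar>z\<bar>\<close> lies
  between the two points \<open>1/\<gamma>\<close> and \<open>\<gamma>/q\<close> where the bound is attained.\<close>

lemma resolvent_denominator_nonzero_off_cut:
  fixes z :: complex
  assumes q: "q > 0" and \<gamma>: "\<gamma> > sqrt q" and z: "z \<notin> cogrowth_cut q \<gamma>"
    and \<mu>: "2 * sqrt q \<le> \<bar>\<mu>\<bar>" "\<bar>\<mu>\<bar> \<le> \<gamma> + q / \<gamma>"
  shows "1 + of_real q * z\<^sup>2 - of_real \<mu> * z \<noteq> 0"
proof
  assume root: "1 + of_real q * z\<^sup>2 - of_real \<mu> * z = 0"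
  have \<gamma>0: "\<gamma> > 0" using q \<gamma> by (meson order_less_trans real_sqrt_gt_zero)
  have "(2 * sqrt q)\<^sup>2 \<le> \<bar>\<mu>\<bar>\<^sup>2" using \<mu>(1) q by (intro power_mono) auto
  then have "\<not> \<mu>\<^sup>2 < 4 * q" using q by (simp add: power_mult_distrib)
  then have re: "z \<in> \<real>" "1 + q * (Re z)\<^sup>2 = \<mu> * Re z"
    using resolvent_denominator_root[OF q root] by auto
  have n: "norm z = \<bar>Re z\<bar>" using re(1) by (metis Re_complex_of_real Reals_cases norm_of_real)
  have "\<mu> * Re z \<le> \<bar>\<mu>\<bar> * norm z" unfolding n abs_mult[symmetric] by simp
  also have "\<dots> \<le> (\<gamma> + q / \<gamma>) * norm z" using \<mu>(2) by (intro mult_right_mono) auto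
  finally have le: "1 + q * (norm z)\<^sup>2 \<le> (\<gamma> + q / \<gamma>) * norm z" using re(2) n by simp
  have "\<gamma>\<^sup>2 > (sqrt q)\<^sup>2" using \<gamma> q by (intro power_strict_mono) auto
  then have "1 / \<gamma> \<le> norm z" "norm z \<le> \<gamma> / q"
    using between_reciprocals[OF q \<gamma>0 _ le] q by auto
  then show False using z re(1) cogrowth_cut_iff[OF \<gamma>0 q] by blast
qed

lemma cogrowth_cut_reciprocal:
  assumes "\<gamma> > 0" "q > 0" "z \<noteq> 0" "1 / (of_real q * z) \<in> cogrowth_cut q \<gamma>"
  shows "z \<in> cogrowth_cut q \<gamma>"
proof -
  have re: "1 / (of_real q * z) \<in> \<real>"
    and le: "1 / \<gamma> \<le> 1 / (q * norm z)" "1 / (q * norm z) \<le> \<gamma> / q"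
    using assms by (simp_all add: cogrowth_cut_iff norm_mult norm_divide)
  have "1 / (of_real q * (1 / (of_real q * z))) \<in> \<real>"
    by (rule Reals_divide[OF Reals_1 Reals_mult[OF Reals_of_real re]])
  moreover have "1 / (of_real q * (1 / (of_real q * z))) = z" using assms by simp
  ultimately have "z \<in> \<real>" by (simp only:)
  moreover have "1 / \<gamma> \<le> norm z" "norm z \<le> \<gamma> / q"
    using le assms by (auto simp: field_simps)
  ultimately show ?thesis using assms by (simp add: cogrowth_cut_iff)
qed

lemma closed_cogrowth_cut: "closed (cogrowth_cut q \<gamma>)"
proof -
  have "compact (complex_of_real ` ({- \<gamma> / q .. - (1 / \<gamma>)} \<union> {1 / \<gamma> .. \<gamma> / q}))"
    by (intro compact_continuous_image continuous_intros compact_Un) auto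
  then show ?thesis by (simp add: cogrowth_cut_def compact_imp_closed)
qed

text \<open>Already the even coefficients force the radius of convergence to be at most \<open>1/\<gamma>\<close>, the distance of
  the cut from the origin. The auxiliary radius \<open>t\<close> makes the inequality strict.\<close>

lemma not_in_cogrowth_cut_of_conv_radius:
  fixes z :: complex
  assumes lim: "(\<lambda>n. root (2 * n) (real (cogrowth N (2 * n)))) \<longlonglongrightarrow> \<gamma>"
    and \<gamma>: "\<gamma> > 0" and q: "q > 0"
    and z: "ereal (norm z) < conv_radius (\<lambda>n. of_nat (cogrowth N n) :: complex)"
  shows "z \<notin> cogrowth_cut q \<gamma>"
proof -
  obtain t where t: "ereal (norm z) < ereal t" "ereal t < conv_radius (\<lambda>n. of_nat (cogrowth N n) :: complex)"
    using ereal_dense2[OF z] by blast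
  have t0: "t > 0" using t(1) by (simp add: order.strict_trans1[OF norm_ge_zero])
  have "summable (\<lambda>n. of_nat (cogrowth N n) * (of_real t :: complex) ^ n)"
    using t t0 by (intro summable_in_conv_radius) simp
  then have "(\<lambda>n. of_nat (cogrowth N n) * (of_real t :: complex) ^ n) \<longlonglongrightarrow> 0"
    by (rule summable_LIMSEQ_zero)
  then have "(\<lambda>n. norm (of_nat (cogrowth N n) * (of_real t :: complex) ^ n)) \<longlonglongrightarrow> 0"
    by (rule tendsto_norm_zero)
  then have "(\<lambda>n. real (cogrowth N n) * t ^ n) \<longlonglongrightarrow> 0"
    using t0 by (simp add: norm_mult norm_power)
  then have "eventually (\<lambda>n. real (cogrowth N n) * t ^ n < 1) sequentially"
    by (rule order_tendstoD) simp
  then obtain n0 where n0: "\<And>n. n \<ge> n0 \<Longrightarrow> real (cogrowth N n) * t ^ n < 1"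
    by (auto simp: eventually_sequentially)
  have "root (2 * n) (real (cogrowth N (2 * n))) \<le> 1 / t" if n: "n \<ge> max 1 n0" for n
  proof -
    have "real (cogrowth N (2 * n)) \<le> (1 / t) ^ (2 * n)"
      using n0[of "2 * n"] n t0 by (simp add: field_simps power_divide)
    then have "root (2 * n) (real (cogrowth N (2 * n))) \<le> root (2 * n) ((1 / t) ^ (2 * n))"
      using n by (intro real_root_le_mono) auto
    also have "\<dots> = 1 / t" using n t0 by (intro real_root_power_cancel) auto
    finally show ?thesis .
  qed
  then have "\<gamma> \<le> 1 / t" by (intro LIMSEQ_le_const2[OF lim]) blast
  then have "t \<le> 1 / \<gamma>" using t0 \<gamma> by (simp add: field_simps)
  then have "norm z < 1 / \<gamma>" using t(1) by simp
  then show ?thesis using \<gamma> q by (simp add: cogrowth_cut_iff)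
qed

section \<open>Splitting the cogrowth series\<close>

text \<open>The decomposition for an abstract bound \<open>R\<close> of the spectrum. The set \<open>S1\<close> contains the part of the
  spectrum outside \<open>[-2 \<surd>q, 2 \<surd>q]\<close>; it may be empty, and then the second summand is \<open>0\<close>. Montel's theorem is
  applied twice, the second time along the subsequence found the first time, so that both
  limits belong to the same sequence of measures.\<close>

lemma cogrowth_series_decomposition:
  fixes q R :: real and S1 :: "real set" and \<Omega>1 :: "complex set"
  assumes N: "subgroup N (free_group r)" and r: "r \<ge> 1" and q: "q = 2 * real r - 1"
    and R: "R > 0"
    and growth: "\<And>e. e > 0 \<Longrightarrow> \<exists>C. \<forall>n. visits r N (2 * n) [] \<le> C * (R + e) ^ (2 * n)"
    and S1: "compact S1" "\<And>\<mu>. \<bar>\<mu>\<bar> \<le> R \<Longrightarrow> \<bar>\<mu>\<bar> > 2 * sqrt q \<Longrightarrow> \<mu> \<in> S1"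
    and \<Omega>1: "open \<Omega>1" "0 \<in> \<Omega>1"
    and nz: "\<And>z \<mu>. z \<in> \<Omega>1 \<Longrightarrow> \<mu> \<in> S1 \<Longrightarrow> 1 + of_real q * z\<^sup>2 - of_real \<mu> * z \<noteq> 0"
  obtains \<gamma>0 \<gamma>1 e where "\<gamma>0 holomorphic_on ball 0 (1 / sqrt q)" "\<gamma>1 holomorphic_on \<Omega>1" "e > 0"
    "\<And>z. norm z < e \<Longrightarrow> (\<lambda>n. of_nat (cogrowth N n) * z ^ n) sums (\<gamma>0 z + \<gamma>1 z)"
    "\<And>z w. \<lbrakk>z \<in> \<Omega>1; w \<in> \<Omega>1; z \<noteq> 0; w = 1 / (of_real q * z); z\<^sup>2 \<noteq> 1; w\<^sup>2 \<noteq> 1\<rbrakk> \<Longrightarrow>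
      z * \<gamma>1 z / (1 - z\<^sup>2) = w * \<gamma>1 w / (1 - w\<^sup>2)"
proof -
  define L where "L = moment_functional (sphere_visits r N 0)"
  have q1: "q \<ge> 1" using q r by simp
  have sub: "N \<subseteq> carrier (free_group r)" using N by (rule subgroup.subset)
  interpret L: positive_functional L R
  proof
    show "L (p * p) \<ge> 0" for p
      unfolding L_def by (rule moment_functional_square_nonneg[OF N])
    show "\<exists>C. \<forall>n. L (monom 1 (2 * n)) \<le> C * (R + e) ^ (2 * n)" if "e > 0" for e
      using growth[OF that] by (simp add: L_def moment_functional_monom sphere_visits_0_left)
  qed (simp_all add: L_def moment_functional_add moment_functional_smult R)
  define w where "w = L.weight 0"
  define \<nu> where "\<nu> = L.node"
  have w: "w k j \<ge> 0" for k j by (simp add: w_def L.weight_nonneg)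
  have "[] \<in> N" using subgroup.one_closed[OF N] by (simp add: free_group_def)
  then have "L 1 = 1"
    using moment_functional_monom[of "sphere_visits r N 0" 1 0]
    by (simp add: L_def sphere_visits_0_left visits_0)
  then have sum_w: "(\<Sum>j\<le>k. w k j) = 1" for k by (simp add: w_def L.sum_weight)
  have \<nu>: "\<bar>\<nu> k j\<bar> \<le> R" if "j \<le> k" for k j using that by (simp add: \<nu>_def L.abs_node_le)
  have lim: "(\<lambda>k. \<Sum>j\<le>k. w k j * poly (sphere_poly q n) (\<nu> k j)) \<longlonglongrightarrow> real (cogrowth N n)" for n
    using L.discrete_approximation[of "sphere_poly q n"]
    by (simp add: w_def \<nu>_def L_def cogrowth_eq_moment_functional[OF q sub])
  define J0 where "J0 k = {j. j \<le> k \<and> \<bar>\<nu> k j\<bar> \<le> 2 * sqrt q}" for k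
  define J1 where "J1 k = {j. j \<le> k \<and> \<bar>\<nu> k j\<bar> > 2 * sqrt q}" for k
  have J: "J0 k \<union> J1 k = {..k}" "J0 k \<inter> J1 k = {}" "finite (J0 k)" "finite (J1 k)" for k
    by (auto simp: J0_def J1_def)
  have wJ: "(\<Sum>j\<in>J0 k. w k j) \<le> 1" "(\<Sum>j\<in>J1 k. w k j) \<le> 1" for k
    unfolding sum_w[of k, symmetric] using J[of k] w by (auto intro!: sum_mono2)
  obtain \<gamma>0 \<rho>0 where \<gamma>0: "\<gamma>0 holomorphic_on ball 0 (1 / sqrt q)" "strict_mono (\<rho>0 :: nat \<Rightarrow> nat)"
    "\<And>z. z \<in> ball 0 (1 / sqrt q) \<Longrightarrow>
      (\<lambda>n. resolvent_sum q (J0 (\<rho>0 n)) (w (\<rho>0 n)) (\<nu> (\<rho>0 n)) z) \<longlonglongrightarrow> \<gamma>0 z"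
  proof (rule resolvent_sum_subsequence[of "{- 2 * sqrt q..2 * sqrt q}" "ball 0 (1 / sqrt q)" q J0 w \<nu>])
    show "1 + of_real q * z\<^sup>2 - of_real \<mu> * z \<noteq> 0"
      if "z \<in> ball 0 (1 / sqrt q)" "\<mu> \<in> {- 2 * sqrt q..2 * sqrt q}" for z :: complex and \<mu>
      by (rule resolvent_denominator_nonzero_disc) (use q1 that in auto)
    show "\<nu> k j \<in> {- 2 * sqrt q..2 * sqrt q}" if "j \<in> J0 k" for k j
      using that by (auto simp: J0_def)
  qed (use w wJ in auto)
  obtain \<gamma>1 \<rho>1 where \<gamma>1: "\<gamma>1 holomorphic_on \<Omega>1" "strict_mono (\<rho>1 :: nat \<Rightarrow> nat)"
    "\<And>z. z \<in> \<Omega>1 \<Longrightarrow>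
      (\<lambda>n. resolvent_sum q (J1 (\<rho>0 (\<rho>1 n))) (w (\<rho>0 (\<rho>1 n))) (\<nu> (\<rho>0 (\<rho>1 n))) z) \<longlonglongrightarrow> \<gamma>1 z"
  proof (rule resolvent_sum_subsequence[of S1 \<Omega>1 q "\<lambda>n. J1 (\<rho>0 n)" "\<lambda>n. w (\<rho>0 n)" "\<lambda>n. \<nu> (\<rho>0 n)"])
    show "\<nu> (\<rho>0 k) j \<in> S1" if "j \<in> J1 (\<rho>0 k)" for k j
      using that by (auto simp: J1_def intro!: S1(2) \<nu>)
  qed (use S1 \<Omega>1 nz w wJ in auto)
  define \<rho> where "\<rho> = \<rho>0 \<circ> \<rho>1"
  have \<rho>: "strict_mono \<rho>" unfolding \<rho>_def using \<gamma>0(2) \<gamma>1(2) by (rule strict_mono_o)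
  obtain e1 where e1: "e1 > 0" "ball 0 e1 \<subseteq> \<Omega>1" using \<Omega>1 open_contains_ball by blast
  define e where "e = Min {e1, 1 / sqrt q, 1 / (R + q + 1)}"
  show thesis
  proof (rule that[OF \<gamma>0(1) \<gamma>1(1)])
    show "e > 0" using e1 q1 R by (simp add: e_def)
    show "(\<lambda>n. of_nat (cogrowth N n) * z ^ n) sums (\<gamma>0 z + \<gamma>1 z)" if "norm z < e" for z
    proof -
      have z: "z \<in> ball 0 (1 / sqrt q)" "z \<in> \<Omega>1" "norm z * (R + q + 1) < 1"
        using that e1 q1 R by (auto simp: e_def field_simps)
      have "(\<lambda>n. resolvent_sum q (J0 (\<rho> n)) (w (\<rho> n)) (\<nu> (\<rho> n)) z +
          resolvent_sum q (J1 (\<rho> n)) (w (\<rho> n)) (\<nu> (\<rho> n)) z) \<longlonglongrightarrow> \<gamma>0 z + \<gamma>1 z"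
        using tendsto_add[OF LIMSEQ_subseq_LIMSEQ[OF \<gamma>0(3)[OF z(1)] \<gamma>1(2)] \<gamma>1(3)[OF z(2)]]
        by (simp add: \<rho>_def o_def)
      also have "(\<lambda>n. resolvent_sum q (J0 (\<rho> n)) (w (\<rho> n)) (\<nu> (\<rho> n)) z +
          resolvent_sum q (J1 (\<rho> n)) (w (\<rho> n)) (\<nu> (\<rho> n)) z) =
          (\<lambda>n. resolvent_sum q {..\<rho> n} (w (\<rho> n)) (\<nu> (\<rho> n)) z)"
        unfolding resolvent_sum_def J(1)[symmetric]
        by (intro ext sum.union_disjoint[symmetric] J)
      finally have F: "(\<lambda>n. resolvent_sum q {..\<rho> n} (w (\<rho> n)) (\<nu> (\<rho> n)) z) \<longlonglongrightarrow> \<gamma>0 z + \<gamma>1 z" .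
      have "(\<lambda>n. of_real (real (cogrowth N n)) * z ^ n) sums (\<gamma>0 z + \<gamma>1 z)"
        by (rule sums_of_discrete_approximation[where w = w and \<nu> = \<nu> and R = R and \<rho> = \<rho> and q = q])
           (use q1 z(3) w sum_w \<nu> lim F \<rho> in simp_all)
      then show ?thesis by simp
    qed
    show "z * \<gamma>1 z / (1 - z\<^sup>2) = v * \<gamma>1 v / (1 - v\<^sup>2)"
      if zv: "z \<in> \<Omega>1" "v \<in> \<Omega>1" "z \<noteq> 0" "v = 1 / (of_real q * z)" "z\<^sup>2 \<noteq> 1" "v\<^sup>2 \<noteq> 1" for z v
    proof -
      define T where "T n = resolvent_sum q (J1 (\<rho> n)) (w (\<rho> n)) (\<nu> (\<rho> n))" for n
      have T: "(\<lambda>n. T n y) \<longlonglongrightarrow> \<gamma>1 y" if "y \<in> \<Omega>1" for y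
        using \<gamma>1(3)[OF that] by (simp add: T_def \<rho>_def)
      have expand: "y * T n y / (1 - y\<^sup>2) =
          (\<Sum>j\<in>J1 (\<rho> n). of_real (w (\<rho> n) j) * (y * resolvent q (\<nu> (\<rho> n) j) y / (1 - y\<^sup>2)))" for n y
        by (simp add: T_def resolvent_sum_def sum_distrib_left sum_divide_distrib mult_ac)
      have "z * T n z / (1 - z\<^sup>2) = v * T n v / (1 - v\<^sup>2)" for n
        unfolding expand
        by (intro sum.cong refl arg_cong2[where f = "(*)"] resolvent_symmetric[where q = q])
           (use zv q1 in auto)
      moreover have "(\<lambda>n. z * T n z / (1 - z\<^sup>2)) \<longlonglongrightarrow> z * \<gamma>1 z / (1 - z\<^sup>2)"
        by (intro tendsto_intros T zv) (use zv in auto)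
      moreover have "(\<lambda>n. v * T n v / (1 - v\<^sup>2)) \<longlonglongrightarrow> v * \<gamma>1 v / (1 - v\<^sup>2)"
        by (intro tendsto_intros T zv) (use zv in auto)
      ultimately show ?thesis by (simp add: LIMSEQ_unique)
    qed
  qed
qed

theorem theorem2:
  fixes G :: "('a, 'b) monoid_scheme" and g :: "nat \<Rightarrow> 'a" and r :: nat
    and N :: "letter list set" and \<phi> :: "letter list set \<Rightarrow> 'a"
    and q \<gamma> :: real
  assumes "r \<ge> 1"
    and "group G"
    and "\<And>i. i < r \<Longrightarrow> g i \<in> carrier G"
    and "generate G (g ` {..<r}) = carrier G"
    and "N \<lhd> free_group r"
    and "\<phi> \<in> iso (free_group r Mod N) G"
    and "\<And>i. i < r \<Longrightarrow> \<phi> (N #>\<^bsub>free_group r\<^esub> free_gen i) = g i"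
    and "q = 2 * real r - 1"
    and "\<gamma> = cogrowth_exponent N"
  shows "\<exists>\<gamma>0 \<gamma>1 :: complex \<Rightarrow> complex.
      \<gamma>0 analytic_on ball 0 (1 / sqrt q) \<and>
      \<gamma>1 analytic_on (UNIV - cogrowth_cut q \<gamma>) \<and>
      (\<forall>z. norm z < 1 / sqrt q \<and>
           ereal (norm z) < conv_radius (\<lambda>n. of_nat (cogrowth N n) :: complex) \<longrightarrow>
           (\<lambda>n. of_nat (cogrowth N n) * z ^ n) sums (\<gamma>0 z + \<gamma>1 z)) \<and>
      (\<forall>z w. z \<notin> cogrowth_cut q \<gamma> \<and> z \<noteq> 0 \<and> w = 1 / (of_real q * z) \<and>
             z\<^sup>2 \<noteq> 1 \<and> w\<^sup>2 \<noteq> 1 \<longrightarrow>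
           z * \<gamma>1 z / (1 - z\<^sup>2) = w * \<gamma>1 w / (1 - w\<^sup>2))"
proof -
  have r: "r \<ge> 1" and q: "q = 2 * real r - 1" and N: "N \<lhd> free_group r" by fact+
  have q1: "q \<ge> 1" using r q by simp
  have sub: "subgroup N (free_group r)" using N by (rule normal_imp_subgroup)
  \<comment> \<open>For \<open>\<gamma> \<le> \<surd>q\<close> the spectrum stays in \<open>[-2 \<surd>q, 2 \<surd>q]\<close>, and so it does for \<open>r = 1\<close>, where \<open>\<gamma>\<close> carries no
    information; then the second summand is \<open>0\<close> and its domain is taken to be the whole plane.\<close>
  define R where "R = (if r \<ge> 2 \<and> \<gamma> > sqrt q then \<gamma> + q / \<gamma> else 2 * sqrt q)"
  define S1 where "S1 = (if r \<ge> 2 \<and> \<gamma> > sqrt q then {- R..- (2 * sqrt q)} \<union> {2 * sqrt q..R} else {})"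
  define \<Omega>1 where "\<Omega>1 = (if r \<ge> 2 \<and> \<gamma> > sqrt q then UNIV - cogrowth_cut q \<gamma> else UNIV)"
  have sq: "sqrt q > 0" using q1 by simp
  have \<gamma>0: "\<gamma> > 0" if "\<gamma> > sqrt q" using that sq by linarith
  have lim: "(\<lambda>n. root (2 * n) (real (cogrowth N (2 * n)))) \<longlonglongrightarrow> \<gamma>" if "r \<ge> 2"
    using cogrowth_exponent_tendsto[OF N that] assms by simp
  have growth: "\<exists>C. \<forall>n. visits r N (2 * n) [] \<le> C * (R + e) ^ (2 * n)" if e: "e > 0" for e
  proof (cases "r \<ge> 2")
    case True
    \<comment> \<open>The function \<open>g + q/g\<close> is minimal at \<open>g = \<surd>q\<close>, with value \<open>2 \<surd>q\<close>.\<close>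
    have "R = max \<gamma> (sqrt q) + q / max \<gamma> (sqrt q)"
      using True q1 by (auto simp: R_def max_def real_div_sqrt)
    moreover have "max \<gamma> (sqrt q) > 0" "max \<gamma> (sqrt q) \<ge> cogrowth_exponent N"
      using sq assms(9) by (simp_all add: less_max_iff_disj)
    ultimately show ?thesis
      using visits_growth[OF N True q _ _ e] by metis
  next
    case False
    then have "r = 1" using r by simp
    have "visits r N (2 * n) [] \<le> 1 * (R + e) ^ (2 * n)" for n
    proof -
      have "visits r N (2 * n) [] \<le> 2 ^ (2 * n)" using visits_le[of r N "2 * n" "[]"] \<open>r = 1\<close> by simp
      also have "\<dots> \<le> (R + e) ^ (2 * n)"
        using e \<open>r = 1\<close> by (intro power_mono) (auto simp: R_def q)
      finally show ?thesis by simp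
    qed
    then show ?thesis by blast
  qed
  have R: "R > 0" using sq \<gamma>0 q1 by (auto simp: R_def intro!: add_pos_nonneg)
  have S1: "compact S1" by (simp add: S1_def compact_Un)
  have S1_covers: "\<mu> \<in> S1" if "\<bar>\<mu>\<bar> \<le> R" "\<bar>\<mu>\<bar> > 2 * sqrt q" for \<mu>
    using that by (auto simp: S1_def R_def abs_if split: if_splits)
  have \<Omega>1: "open \<Omega>1" using closed_cogrowth_cut by (simp add: \<Omega>1_def open_Diff)
  have \<Omega>1_0: "0 \<in> \<Omega>1" using \<gamma>0 q1 by (auto simp: \<Omega>1_def cogrowth_cut_iff)
  have nz: "1 + of_real q * z\<^sup>2 - of_real \<mu> * z \<noteq> 0" if "z \<in> \<Omega>1" "\<mu> \<in> S1" for z :: complex and \<mu>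
  proof -
    have c: "r \<ge> 2 \<and> \<gamma> > sqrt q" using that(2) by (auto simp: S1_def split: if_splits)
    then have "- R \<le> \<mu> \<and> \<mu> \<le> - (2 * sqrt q) \<or> 2 * sqrt q \<le> \<mu> \<and> \<mu> \<le> R"
      using that(2) by (simp add: S1_def)
    then have "2 * sqrt q \<le> \<bar>\<mu>\<bar> \<and> \<bar>\<mu>\<bar> \<le> R" using sq by linarith
    then have "2 * sqrt q \<le> \<bar>\<mu>\<bar> \<and> \<bar>\<mu>\<bar> \<le> \<gamma> + q / \<gamma>" using c by (simp add: R_def)
    then show ?thesis
      using c that(1) q1 by (intro resolvent_denominator_nonzero_off_cut) (auto simp: \<Omega>1_def)
  qed
  obtain \<gamma>0 \<gamma>1 e where
    dec: "\<gamma>0 holomorphic_on ball 0 (1 / sqrt q)" "\<gamma>1 holomorphic_on \<Omega>1" "e > 0"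
    "\<And>z. norm z < e \<Longrightarrow> (\<lambda>n. of_nat (cogrowth N n) * z ^ n) sums (\<gamma>0 z + \<gamma>1 z)"
    "\<And>z w. \<lbrakk>z \<in> \<Omega>1; w \<in> \<Omega>1; z \<noteq> 0; w = 1 / (of_real q * z); z\<^sup>2 \<noteq> 1; w\<^sup>2 \<noteq> 1\<rbrakk> \<Longrightarrow>
      z * \<gamma>1 z / (1 - z\<^sup>2) = w * \<gamma>1 w / (1 - w\<^sup>2)"
    by (rule cogrowth_series_decomposition[OF sub r q R _ S1 _ \<Omega>1 \<Omega>1_0])
      ((rule growth S1_covers nz that; assumption) | assumption)+
  have \<Omega>1_sub: "UNIV - cogrowth_cut q \<gamma> \<subseteq> \<Omega>1" by (auto simp: \<Omega>1_def)
  show ?thesis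
  proof (intro exI conjI allI impI; (elim conjE)?)
    show "\<gamma>0 analytic_on ball 0 (1 / sqrt q)" using dec(1) by (simp add: analytic_on_open)
    show "\<gamma>1 analytic_on UNIV - cogrowth_cut q \<gamma>"
      using dec(2) \<open>open \<Omega>1\<close> \<Omega>1_sub analytic_on_open analytic_on_subset by blast
  next
    fix z :: complex
    assume z: "norm z < 1 / sqrt q" "ereal (norm z) < conv_radius (\<lambda>n. of_nat (cogrowth N n) :: complex)"
    \<comment> \<open>On a slightly larger disc both summands are holomorphic, because it avoids the cut.\<close>
    obtain \<rho> where \<rho>: "ereal (norm z) < ereal \<rho>"
      "ereal \<rho> < min (ereal (1 / sqrt q)) (conv_radius (\<lambda>n. of_nat (cogrowth N n) :: complex))"
      using ereal_dense2[of "ereal (norm z)"] z by (metis less_ereal.simps(1) min_less_iff_conj)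
    have "ball 0 \<rho> \<subseteq> \<Omega>1"
    proof
      fix y :: complex assume "y \<in> ball 0 \<rho>"
      then have "ereal (norm y) < conv_radius (\<lambda>n. of_nat (cogrowth N n) :: complex)"
        using \<rho>(2) by (simp add: order.strict_trans[of _ "ereal \<rho>"])
      then show "y \<in> \<Omega>1"
        using not_in_cogrowth_cut_of_conv_radius[OF lim] \<open>\<gamma> > sqrt q \<Longrightarrow> \<gamma> > 0\<close> q1
        by (auto simp: \<Omega>1_def)
    qed
    then have "(\<lambda>z. \<gamma>0 z + \<gamma>1 z) holomorphic_on ball 0 \<rho>"
      using dec(1,2) \<rho>(2) by (intro holomorphic_intros) (auto elim!: holomorphic_on_subset)
    then show "(\<lambda>n. of_nat (cogrowth N n) * z ^ n) sums (\<gamma>0 z + \<gamma>1 z)"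
      by (rule power_series_extension[OF _ _ dec(3,4)]) (use \<rho>(1) in auto)
  next
    fix z w :: complex
    assume zw: "z \<notin> cogrowth_cut q \<gamma>" "z \<noteq> 0" "w = 1 / (of_real q * z)" "z\<^sup>2 \<noteq> 1" "w\<^sup>2 \<noteq> 1"
    have "z \<in> \<Omega>1" using zw \<Omega>1_sub by blast
    moreover have "w \<in> \<Omega>1"
      using zw cogrowth_cut_reciprocal[of \<gamma> q z] \<open>\<gamma> > sqrt q \<Longrightarrow> \<gamma> > 0\<close> q1 by (auto simp: \<Omega>1_def)
    ultimately show "z * \<gamma>1 z / (1 - z\<^sup>2) = w * \<gamma>1 w / (1 - w\<^sup>2)"
      using zw by (intro dec(5))
  qed
qed

end
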